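(* Let $A$ be a real $n\times n$ matrix such that $S(A)=(A+A^T)/2$ is symmetric positive definite and let $\lambda_{\min}[S(A)]>0$ denote the smallest eigenvalue of $S(A)$. The residual $\mathbf r_k$ obtained by restarted GMRES (restarting after $\ell$ inner steps) applied to a linear system $A\mathbf x=\mathbf b$, after $k$ outer steps, satisfies $$\frac{\|\mathbf r_k\|_2}{\|\mathbf r_0\|_2}\le\left(1-\frac{(\lambda_{\min}[S(A)])^2}{\|A\|_2^2}\right)^{k\ell/2}.$$ The cost of one outer step of restarted GMRES is $$\mathrm{cost}_1^{\mathrm{GMRES}}=\ell\cdot \mathrm{cost}_{\mathrm{Mv}}+c_7\,(n\ell^2+\ell^2).$$
   Context: Restarted GMRES($\ell$) for $A\mathbf x=\mathbf b$ with initial vector $\mathbf x^{[0]}$: let $\mathbf r_k=\mathbf b-A\mathbf x^{[k]}$ (with $\mathbf r_0\neq\mathbf 0$). In outer step $k=0,1,2,\ldots$, set $\beta=\|\mathbf r_k\|_2$, stopping with the solution $\mathbf x^{[k]}$ if $\beta$ is below the tolerance (in particular if it is zero); set $\mathbf v_1=\mathbf r_k/\beta$; generate by the Arnoldi process an orthonormal basis $V_{\ell+1}=[\mathbf v_1,\ldots,\mathbf v_{\ell+1}]$ of the Krylov space $\mathrm{span}\{\mathbf r_k,A\mathbf r_k,\ldots,A^{\ell}\mathbf r_k\}$ and an upper Hessenberg matrix $\bar H_\ell\in\mathbb R^{(\ell+1)\times\ell}$ with $AV_\ell=V_{\ell+1}\bar H_\ell$, where $V_\ell=[\mathbf v_1,\ldots,\mathbf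 v_\ell]$; compute $\mathbf y^{[k]}=\arg\min_{\mathbf y}\|\beta\mathbf e_1-\bar H_\ell\mathbf y\|_2^2$; set $\mathbf x^{[k+1]}=\mathbf x^{[k]}+V_\ell\mathbf y^{[k]}$. Equivalently, $\mathbf x^{[k+1]}$ minimizes $\|\mathbf b-A\mathbf x\|_2$ over $\mathbf x\in\mathbf x^{[k]}+\mathrm{span}\{\mathbf r_k,A\mathbf r_k,\ldots,A^{\ell-1}\mathbf r_k\}$, so $\|\mathbf r_{k+1}\|_2=\min\{\|p(A)\mathbf r_k\|_2: p \text{ a polynomial of degree}\le\ell,\ p(0)=1\}$. Cost is counted in floating-point operations. $\mathrm{cost}_{\mathrm{Mv}}$ is the cost of one matrix-vector product with $A$, proportional to the number of nonzero entries of $A$. The symbol $c_7$ denotes a small positive constant; the paper's convention is that the constants $c_1,c_2,\ldots$ in its cost bounds are all less than $10$. $\|\cdot\|_2$ is the matrix or vector 2-norm.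
   Formalization: No single constant c_7 gives exact equality (for l=1 the count is 8n+10), so c_7 is a number in [1,9] that may vary; equality is claimed when the Krylov space has dimension l+1, otherwise only the upper bound with 9; a fused multiply-add counts as one operation. *)

theory Defs
  imports "HOL-Analysis.Analysis" "HOL-Library.Monad_Syntax"
begin

section \<open>Symmetric part and smallest eigenvalue\<close>

definition sym_part :: "real^'n^'n \<Rightarrow> real^'n^'n" where
  "sym_part A = (1/2) *\<^sub>R (A + transpose A)"

definition sym_pos_def :: "real^'n^'n \<Rightarrow> bool" where
  "sym_pos_def M \<longleftrightarrow> transpose M = M \<and> (\<forall>v. v \<noteq> 0 \<longrightarrow> v \<bullet> (M *v v) > 0)"

definition eigenvalues :: "real^'n^'n \<Rightarrow> real set" where
  "eigenvalues M = {\<mu>. \<exists>v. v \<noteq> 0 \<and> M *v v = \<mu> *\<^sub>R v}"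

text \<open>Only used for symmetric \<open>M\<close>, where the set of real eigenvalues is finite and nonempty.\<close>

definition lambda_min :: "real^'n^'n \<Rightarrow> real" where
  "lambda_min M = Min (eigenvalues M)"


section \<open>One outer step of restarted GMRES\<close>

definition residual :: "real^'n^'n \<Rightarrow> real^'n \<Rightarrow> real^'n \<Rightarrow> real^'n" where
  "residual A b x = b - A *v x"

definition krylov :: "real^'n^'n \<Rightarrow> real^'n \<Rightarrow> nat \<Rightarrow> (real^'n) set" where
  "krylov A r m = span ((\<lambda>i. (((*v) A) ^^ i) r) ` {..<m})"

text \<open>
  Indices start at 0. The generic case is \<open>d = l + 1\<close>, with \<open>m = l\<close> Arnoldi steps and \<open>H\<close> of size
  \<open>(l + 1) \<times> l\<close>. If the Krylov space has dimension \<open>d \<le> l\<close>, the Arnoldi process breaks down: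
  it ends after \<open>m = d\<close> steps with the relation \<open>A V = V H\<close> for a square \<open>H\<close>, because the last row of
  the Hessenberg matrix vanishes. Only the entries \<open>V i\<close>, \<open>H i j\<close> with \<open>i < d\<close>, \<open>j < m\<close> matter.
\<close>

definition arnoldi_decomposition ::
    "real^'n^'n \<Rightarrow> real^'n \<Rightarrow> nat \<Rightarrow> nat \<Rightarrow> nat \<Rightarrow> (nat \<Rightarrow> real^'n) \<Rightarrow> (nat \<Rightarrow> nat \<Rightarrow> real) \<Rightarrow> bool" where
  "arnoldi_decomposition A r l d m V H \<longleftrightarrow>
     d = dim (krylov A r (l + 1)) \<and> m = min l d \<and>
     V 0 = (1 / norm r) *\<^sub>R r \<and>
     (\<forall>i<d. \<forall>j<d. V i \<bullet> V j = (if i = j then 1 else 0)) \<and>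
     span (V ` {..<d}) = krylov A r (l + 1) \<and>
     (\<forall>i<d. \<forall>j<m. j + 1 < i \<longrightarrow> H i j = 0) \<and>
     (\<forall>j<m. A *v V j = (\<Sum>i<d. H i j *\<^sub>R V i))"

text \<open>The squared norm of \<open>\<beta> e\<^sub>1 - H y\<close> for a \<open>d \<times> m\<close> matrix \<open>H\<close>.\<close>

definition ls_objective :: "nat \<Rightarrow> nat \<Rightarrow> real \<Rightarrow> (nat \<Rightarrow> nat \<Rightarrow> real) \<Rightarrow> (nat \<Rightarrow> real) \<Rightarrow> real" where
  "ls_objective d m \<beta> H y = (\<Sum>i<d. ((if i = 0 then \<beta> else 0) - (\<Sum>j<m. H i j * y j))\<^sup>2)"

text \<open>
  A step from \<open>x\<close> to \<open>x'\<close>. A vanishing residual stops the iteration, modelled by letting \<open>x\<close> stay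
  fixed. A positive stopping tolerance only decides how many of these steps are carried out.
\<close>

definition gmres_step :: "real^'n^'n \<Rightarrow> real^'n \<Rightarrow> nat \<Rightarrow> real^'n \<Rightarrow> real^'n \<Rightarrow> bool" where
  "gmres_step A b l x x' \<longleftrightarrow>
     (if residual A b x = 0 then x' = x
      else \<exists>d m V H y.
        arnoldi_decomposition A (residual A b x) l d m V H \<and>
        is_arg_min (ls_objective d m (norm (residual A b x)) H) (\<lambda>_. True) y \<and>
        x' = x + (\<Sum>j<m. y j *\<^sub>R V j))"


section \<open>Computations with a floating-point operation count\<close>

text \<open>
  The second component is the number of floating-point operations. An operation is one of the
  basic real operations of IEEE 754: addition, subtraction, multiplication, division, square root, or a fused
  multiply-add \<open>a * b + c\<close>. Sign changes and comparisons are not counted.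
\<close>

type_synonym 'a counted = "'a \<times> real"

definition ret :: "'a \<Rightarrow> 'a counted" where
  "ret a = (a, 0)"

definition bind_counted :: "'a counted \<Rightarrow> ('a \<Rightarrow> 'b counted) \<Rightarrow> 'b counted" where
  "bind_counted p f = (fst (f (fst p)), snd p + snd (f (fst p)))"

adhoc_overloading
  Monad_Syntax.bind \<rightleftharpoons> bind_counted

definition op_mul :: "real \<Rightarrow> real \<Rightarrow> real counted" where
  "op_mul a b = (a * b, 1)"

definition op_div :: "real \<Rightarrow> real \<Rightarrow> real counted" where
  "op_div a b = (a / b, 1)"

definition op_sqrt :: "real \<Rightarrow> real counted" where
  "op_sqrt a = (sqrt a, 1)"

definition op_fma :: "real \<Rightarrow> real \<Rightarrow> real \<Rightarrow> real counted" where
  "op_fma a b c = (a * b + c, 1)"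

text \<open>
  Vector kernels in dimension \<open>n = CARD('n)\<close>: \<open>n\<close> fused multiply-adds (inner product, update) or
  \<open>n\<close> divisions.
\<close>

definition op_dot :: "real^'n \<Rightarrow> real^'n \<Rightarrow> real counted" where
  "op_dot v w = (v \<bullet> w, real CARD('n))"

definition op_axpy :: "real \<Rightarrow> real^'n \<Rightarrow> real^'n \<Rightarrow> (real^'n) counted" where
  "op_axpy a v w = (a *\<^sub>R v + w, real CARD('n))"

definition op_vdiv :: "real^'n \<Rightarrow> real \<Rightarrow> (real^'n) counted" where
  "op_vdiv v a = ((1 / a) *\<^sub>R v, real CARD('n))"

definition op_norm :: "real^'n \<Rightarrow> real counted" where
  "op_norm v = do { s \<leftarrow> op_dot v v; op_sqrt s }"

definition nnz :: "real^'n^'n \<Rightarrow> nat" where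
  "nnz A = card {(i, j). A $ i $ j \<noteq> 0}"

definition cost_Mv :: "real \<Rightarrow> real^'n^'n \<Rightarrow> real" where
  "cost_Mv \<gamma> A = \<gamma> * real (nnz A)"

definition op_matvec :: "real \<Rightarrow> real^'n^'n \<Rightarrow> real^'n \<Rightarrow> (real^'n) counted" where
  "op_matvec \<gamma> A v = (A *v v, cost_Mv \<gamma> A)"


section \<open>The outer step as a computation\<close>

subsection \<open>Arnoldi process with modified Gram-Schmidt\<close>

fun orthogonalize :: "(real^'n) list \<Rightarrow> real^'n \<Rightarrow> (real list \<times> (real^'n)) counted" where
  "orthogonalize [] w = ret ([], w)"
| "orthogonalize (v # vs) w = do {
     h \<leftarrow> op_dot v w;
     w' \<leftarrow> op_axpy (- h) v w;
     (hs, u) \<leftarrow> orthogonalize vs w';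
     ret (h # hs, u)
   }"

text \<open>
  State: the basis vectors \<open>V\<close>, the products \<open>W\<close> of \<open>A\<close> with the basis vectors treated so far, and the
  columns \<open>H\<close> of the Hessenberg matrix; column \<open>j\<close> is stored as its \<open>j + 2\<close> leading entries.
\<close>

fun arnoldi :: "real \<Rightarrow> real^'n^'n \<Rightarrow> nat \<Rightarrow> (real^'n) list \<Rightarrow> (real^'n) list \<Rightarrow> real list list
    \<Rightarrow> ((real^'n) list \<times> (real^'n) list \<times> real list list) counted" where
  "arnoldi \<gamma> A 0 V W H = ret (V, W, H)"
| "arnoldi \<gamma> A (Suc k) V W H = do {
     w \<leftarrow> op_matvec \<gamma> A (last V);
     (h, u) \<leftarrow> orthogonalize V w;
     \<eta> \<leftarrow> op_norm u;
     if \<eta> = 0 then ret (V, W @ [w], H @ [h @ [0]])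
     else do {
       v \<leftarrow> op_vdiv u \<eta>;
       arnoldi \<gamma> A k (V @ [v]) (W @ [w]) (H @ [h @ [\<eta>]])
     }
   }"

subsection \<open>Least-squares problem by Givens rotations\<close>

text \<open>
  Applies the rotations \<open>(c, s)\<close> of the previous columns to a new column, then generates the
  rotation that annihilates its last entry. Returns the new column of the triangular factor
  together with that rotation.
\<close>

fun reduce_column :: "(real \<times> real) list \<Rightarrow> real list \<Rightarrow> (real list \<times> real \<times> real) counted" where
  "reduce_column [] (a # b # _) = do {
     q \<leftarrow> op_mul b b;
     p \<leftarrow> op_fma a a q;
     t \<leftarrow> op_sqrt p;
     c \<leftarrow> op_div a t;
     s \<leftarrow> op_div b t;
     ret ([t], c, s)
   }"
| "reduce_column ((c, s) # G) (a # b # h) = do {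
     p \<leftarrow> op_mul s b;
     a' \<leftarrow> op_fma c a p;
     q \<leftarrow> op_mul c b;
     b' \<leftarrow> op_fma (- s) a q;
     (rs, g) \<leftarrow> reduce_column G (b' # h);
     ret (a' # rs, g)
   }"
| "reduce_column _ _ = ret ([], 1, 0)"  (* not reached *)

text \<open>\<open>\<tau>\<close> is the last nonzero entry of the rotated right-hand side, which starts as \<open>\<beta> e\<^sub>1\<close>.\<close>

fun givens_qr :: "(real \<times> real) list \<Rightarrow> real \<Rightarrow> real list list
    \<Rightarrow> (real list list \<times> real list) counted" where
  "givens_qr G \<tau> [] = ret ([], [])"
| "givens_qr G \<tau> (h # H) = do {
     (rs, c, s) \<leftarrow> reduce_column G h;
     e \<leftarrow> op_mul c \<tau>;
     \<tau>' \<leftarrow> op_mul (- s) \<tau>;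
     (R, g) \<leftarrow> givens_qr (G @ [(c, s)]) \<tau>' H;
     ret (rs # R, e # g)
   }"

fun list_axpy :: "real \<Rightarrow> real list \<Rightarrow> real list \<Rightarrow> real list counted" where
  "list_axpy a (x # xs) (z # zs) = do {
     u \<leftarrow> op_fma a x z;
     us \<leftarrow> list_axpy a xs zs;
     ret (u # us)
   }"
| "list_axpy _ _ _ = ret []"

text \<open>Column-oriented back substitution; takes the columns of the triangular factor last one first.\<close>

fun back_substitution :: "real list list \<Rightarrow> real list \<Rightarrow> real list \<Rightarrow> real list counted" where
  "back_substitution [] g ys = ret ys"
| "back_substitution (rs # R) g ys = do {
     y \<leftarrow> op_div (last g) (last rs);
     g' \<leftarrow> list_axpy (- y) (butlast rs) (butlast g);
     back_substitution R g' (y # ys)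
   }"

definition hessenberg_ls :: "real \<Rightarrow> real list list \<Rightarrow> real list counted" where
  "hessenberg_ls \<beta> H = do {
     (R, g) \<leftarrow> givens_qr [] \<beta> H;
     back_substitution (rev R) g []
   }"

subsection \<open>Outer step\<close>

fun add_combination :: "real list \<Rightarrow> (real^'n) list \<Rightarrow> real^'n \<Rightarrow> (real^'n) counted" where
  "add_combination (y # ys) (v # vs) x = do { x' \<leftarrow> op_axpy y v x; add_combination ys vs x' }"
| "add_combination _ _ x = ret x"

text \<open>
  Maps the pair of current iterate and residual to the next pair. The new residual is
  \<open>b - A (x + V y) = r - (A V) y\<close>, where the products in \<open>A V\<close> are those already formed in the Arnoldi
  process, so that no further matrix-vector product is needed.
\<close>

definition gmres_outer :: "real \<Rightarrow> real^'n^'n \<Rightarrow> nat \<Rightarrow> (real^'n) \<times> (real^'n)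
    \<Rightarrow> ((real^'n) \<times> (real^'n)) counted" where
  "gmres_outer \<gamma> A l = (\<lambda>(x, r). do {
     \<beta> \<leftarrow> op_norm r;
     if \<beta> = 0 then ret (x, r)
     else do {
       v \<leftarrow> op_vdiv r \<beta>;
       (V, W, H) \<leftarrow> arnoldi \<gamma> A l [v] [] [];
       y \<leftarrow> hessenberg_ls \<beta> H;
       x' \<leftarrow> add_combination y V x;
       r' \<leftarrow> add_combination (map uminus y) W r;
       ret (x', r')
     }
   })"

end

theory Submission
  imports Defs "HOL-Library.More_List"
begin

text \<open>
  Convergence. GMRES minimizes the residual norm over all polynomials of degree at most \<open>l\<close> with
  value \<open>1\<close> at \<open>0\<close>, so every such polynomial gives an upper bound. The bound comes from
  \<open>(1 - \<alpha> t)\<^sup>l\<close>, that is, from \<open>l\<close> steps of the Richardson iteration. With the step length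
  \<open>\<alpha> = \<lambda> / L\<^sup>2\<close>, where \<open>\<lambda>\<close> is the smallest eigenvalue of the symmetric part and \<open>L\<close> the norm of \<open>A\<close>,
  one Richardson step contracts every vector by the factor \<open>sqrt (1 - \<lambda>\<^sup>2 / L\<^sup>2)\<close>
  (\<open>richardson_contraction\<close>), because \<open>v \<bullet> A v \<ge> \<lambda> (v \<bullet> v)\<close> and \<open>\<bar>A v\<bar> \<le> L \<bar>v\<bar>\<close>. The first of these
  inequalities rests on the fact that the minimum of the Rayleigh quotient of a symmetric matrix
  is an eigenvalue (\<open>symmetric_rayleigh_eigenvalue\<close>). That GMRES does at least as well is
  \<open>gmres_step_optimal\<close>.

  Correctness of the computation. Modified Gram-Schmidt yields an Arnoldi decomposition
  (\<open>arnoldi_correct\<close>, \<open>arnoldi_inv_decomposition\<close>). For the least-squares problem it suffices to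
  verify the normal equations, that is, that the new residual is orthogonal to the columns of
  \<open>A V\<close>. Instead of orthogonal matrices, the proof follows the basis vectors: each Givens rotation
  turns two of them into a settled vector and a carried one (\<open>settled\<close>, \<open>carried\<close>). The columns of
  \<open>A V\<close> are combinations of settled vectors with triangular coefficients
  (\<open>reduce_column_settled\<close>), back substitution removes the settled components of the residual, and
  the remaining multiple of the carried vector is orthogonal to all columns
  (\<open>hessenberg_ls_correct\<close>). A breakdown is included by padding the basis with zero vectors. The
  last pivot is then nonzero because \<open>A\<close> is injective.

  Cost. The same inductions count operations. Without a breakdown, the operations other than the
  \<open>l\<close> matrix-vector products sum to \<open>n (l\<^sup>2 + 5 l + 2) + (5 l\<^sup>2 + 13 l) / 2 + 1\<close>, which lies between
  \<open>n l\<^sup>2 + l\<^sup>2\<close> and nine times this number (\<open>outer_step_cost_bounds\<close>).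
\<close>

section \<open>The smallest eigenvalue of the symmetric part\<close>

lemma inner_sym_part: "v \<bullet> (sym_part A *v v) = v \<bullet> (A *v v)"
proof -
  have "v \<bullet> (transpose A *v v) = v \<bullet> (A *v v)"
    by (metis dot_lmul_matrix inner_commute transpose_matrix_vector)
  then show ?thesis
    by (simp add: sym_part_def scaleR_matrix_vector_assoc[symmetric] matrix_vector_mult_add_rdistrib
        inner_add_right)
qed

lemma symmetric_inner_commute:
  fixes M :: "real^'n^'n"
  assumes "transpose M = M"
  shows "u \<bullet> (M *v v) = v \<bullet> (M *v u)"
  by (metis assms dot_lmul_matrix inner_commute transpose_matrix_vector)

text \<open>
  The Rayleigh quotient attains its minimum \<open>\<mu>\<close> on the unit sphere. At a minimizer \<open>u\<close> the
  form \<open>v \<bullet> M v - \<mu> (v \<bullet> v)\<close> is nonnegative and vanishes, so its derivative there vanishes too,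
  and for a symmetric \<open>M\<close> that derivative is twice \<open>M u - \<mu> u\<close>.
\<close>
lemma symmetric_rayleigh_eigenvalue:
  fixes M :: "real^'n^'n"
  assumes sym: "transpose M = M"
  shows "\<exists>\<mu>\<in>eigenvalues M. \<forall>v. \<mu> * (v \<bullet> v) \<le> v \<bullet> (M *v v)"
proof -
  have "compact (sphere (0::real^'n) 1)" by simp
  moreover have "sphere (0::real^'n) 1 \<noteq> {}" by simp
  moreover have "continuous_on (sphere 0 1) (\<lambda>v::real^'n. v \<bullet> (M *v v))"
    by (intro continuous_intros matrix_vector_mult_linear_continuous_on)
  ultimately obtain u :: "real^'n" where u: "u \<in> sphere 0 1"
    and umin: "\<And>v. v \<in> sphere 0 1 \<Longrightarrow> u \<bullet> (M *v u) \<le> v \<bullet> (M *v v)"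
    using continuous_attains_inf[of "sphere 0 1" "\<lambda>v. v \<bullet> (M *v v)"] by blast
  define \<mu> where "\<mu> = u \<bullet> (M *v u)"
  have uu: "u \<bullet> u = 1" using u by (simp add: norm_eq_1)
  have ray: "\<mu> * (v \<bullet> v) \<le> v \<bullet> (M *v v)" for v
  proof (cases "v = 0")
    case False
    define v' where "v' = (1 / norm v) *\<^sub>R v"
    have "v' \<in> sphere 0 1" using False by (simp add: v'_def)
    then have "\<mu> \<le> v' \<bullet> (M *v v')" unfolding \<mu>_def by (rule umin)
    also have "\<dots> = (v \<bullet> (M *v v)) / (v \<bullet> v)"
      by (simp add: v'_def matrix_vector_mult_scaleR dot_square_norm power2_eq_square)
    finally show ?thesis using False by (simp add: field_simps)
  qed simp
  define z where "z = M *v u - \<mu> *\<^sub>R u"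
  define a where "a = z \<bullet> z"
  define c where "c = z \<bullet> (M *v z) - \<mu> * (z \<bullet> z)"
  have "z = 0"
  proof (rule ccontr)
    assume "z \<noteq> 0"
    then have a: "a > 0" by (simp add: a_def)
    have c: "c \<ge> 0" using ray[of z] by (simp add: c_def)
    \<comment> \<open>The value of the form at \<open>u + t z\<close>, a polynomial in \<open>t\<close> with the slope \<open>2 a\<close> at \<open>0\<close>.\<close>
    have quad: "0 \<le> 2 * t * a + t\<^sup>2 * c" for t
    proof -
      have "0 \<le> (u + t *\<^sub>R z) \<bullet> (M *v (u + t *\<^sub>R z)) - \<mu> * ((u + t *\<^sub>R z) \<bullet> (u + t *\<^sub>R z))"
        using ray[of "u + t *\<^sub>R z"] by simp
      also have "\<dots> = 2 * t * (z \<bullet> (M *v u) - \<mu> * (z \<bullet> u)) + t\<^sup>2 * c"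
        using uu symmetric_inner_commute[OF sym, of u z]
        by (simp add: matrix_vector_right_distrib matrix_vector_mult_scaleR inner_add_left
            inner_add_right c_def \<mu>_def[symmetric] inner_commute[of u z] algebra_simps
            power2_eq_square)
      also have "z \<bullet> (M *v u) - \<mu> * (z \<bullet> u) = a"
        by (simp add: a_def z_def inner_diff_right)
      finally show ?thesis by simp
    qed
    \<comment> \<open>A negative step so short that the linear term outweighs the quadratic one; the \<open>1\<close> covers
       the case \<open>c = 0\<close>.\<close>
    define t where "t = a / (c + 1)"
    have at: "a = t * (c + 1)" and t: "t > 0" using a c by (simp_all add: t_def)
    have "2 * (- t) * a + (- t)\<^sup>2 * c = - (t\<^sup>2 * (c + 2))"
      unfolding at by (simp add: algebra_simps power2_eq_square)
    moreover have "t\<^sup>2 * (c + 2) > 0" using t c by simp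
    ultimately show False using quad[of "- t"] by linarith
  qed
  then have "\<mu> \<in> eigenvalues M"
    using uu by (auto simp: eigenvalues_def z_def intro!: exI[of _ u])
  with ray show ?thesis by blast
qed

text \<open>
  One eigenvector per eigenvalue gives pairwise orthogonal nonzero vectors, which are
  independent. Finiteness is what makes \<open>Min\<close> in \<open>lambda_min\<close> a true minimum.
\<close>
lemma symmetric_finite_eigenvalues:
  fixes M :: "real^'n^'n"
  assumes sym: "transpose M = M"
  shows "finite (eigenvalues M)"
proof -
  define f where "f \<mu> = (SOME v. v \<noteq> 0 \<and> M *v v = \<mu> *\<^sub>R v)" for \<mu>
  have f: "f \<mu> \<noteq> 0 \<and> M *v f \<mu> = \<mu> *\<^sub>R f \<mu>" if "\<mu> \<in> eigenvalues M" for \<mu>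
    using that unfolding eigenvalues_def f_def mem_Collect_eq by (rule someI_ex)
  have orth: "f \<mu> \<bullet> f \<nu> = 0" if "\<mu> \<in> eigenvalues M" "\<nu> \<in> eigenvalues M" "\<mu> \<noteq> \<nu>" for \<mu> \<nu>
    using symmetric_inner_commute[OF sym, of "f \<mu>" "f \<nu>"] f[OF that(1)] f[OF that(2)] that(3)
    by (simp add: inner_commute)
  have "inj_on f (eigenvalues M)"
    by (rule inj_onI) (metis f inner_eq_zero_iff orth)
  moreover have "pairwise orthogonal (f ` eigenvalues M)"
    using orth by (auto simp: pairwise_def orthogonal_def)
  moreover have "0 \<notin> f ` eigenvalues M" using f by force
  ultimately show ?thesis
    by (metis finite_imageD independent_imp_finite pairwise_orthogonal_independent)
qed

lemma lambda_min_pos: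
  assumes "sym_pos_def M"
  shows "0 < lambda_min M"
proof -
  have sym: "transpose M = M" using assms by (simp add: sym_pos_def_def)
  have "lambda_min M \<in> eigenvalues M"
    unfolding lambda_min_def
    using symmetric_rayleigh_eigenvalue[OF sym] symmetric_finite_eigenvalues[OF sym]
    by (intro Min_in) auto
  then obtain v where "v \<noteq> 0" "M *v v = lambda_min M *\<^sub>R v" by (auto simp: eigenvalues_def)
  moreover from this have "0 < v \<bullet> (M *v v)" using assms unfolding sym_pos_def_def by blast
  ultimately show ?thesis using inner_ge_zero[of v] by (auto simp: zero_less_mult_iff)
qed

lemma lambda_min_rayleigh:
  assumes "transpose M = M"
  shows "lambda_min M * (v \<bullet> v) \<le> v \<bullet> (M *v v)"
proof -
  obtain \<mu> where \<mu>: "\<mu> \<in> eigenvalues M" "\<mu> * (v \<bullet> v) \<le> v \<bullet> (M *v v)"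
    using symmetric_rayleigh_eigenvalue[OF assms] by blast
  have "lambda_min M \<le> \<mu>"
    unfolding lambda_min_def by (rule Min_le[OF symmetric_finite_eigenvalues[OF assms] \<mu>(1)])
  then show ?thesis using \<mu>(2) by (meson inner_ge_zero mult_right_mono order_trans)
qed

section \<open>Richardson iteration\<close>

lemma pos_def_mult_eq_0:
  assumes "sym_pos_def (sym_part A)" "A *v v = 0"
  shows "v = 0"
  using assms inner_sym_part[of v A] by (force simp: sym_pos_def_def)

lemma pos_def_inj:
  assumes "sym_pos_def (sym_part A)"
  shows "inj ((*v) A)"
proof (rule injI)
  fix u v assume "A *v u = A *v v"
  then have "A *v (u - v) = 0" by (simp add: matrix_vector_mult_diff_distrib)
  then show "u = v" using pos_def_mult_eq_0[OF assms] by fastforce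
qed

text \<open>
  Expanding the square of the left-hand side gives at most
  \<open>(1 - 2 \<alpha> \<mu> + \<alpha>\<^sup>2 L\<^sup>2) (v \<bullet> v)\<close> for a step length \<open>\<alpha> > 0\<close>. The choice \<open>\<alpha> = \<mu> / L\<^sup>2\<close> minimizes
  this factor.
\<close>
lemma richardson_contraction:
  fixes A :: "real^'n^'n"
  assumes pd: "sym_pos_def (sym_part A)"
  defines "\<mu> \<equiv> lambda_min (sym_part A)" and "L \<equiv> onorm ((*v) A)"
  shows "norm (v - (\<mu> / L\<^sup>2) *\<^sub>R (A *v v)) \<le> sqrt (1 - \<mu>\<^sup>2 / L\<^sup>2) * norm v"
proof -
  have lin: "bounded_linear ((*v) A)" by simp
  have L0: "L \<ge> 0" unfolding L_def by (rule onorm_pos_le[OF lin])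
  have "L \<noteq> 0"
  proof
    assume "L = 0"
    then have "A *v axis undefined 1 = 0" using onorm[OF lin, of "axis undefined 1"] by (simp add: L_def)
    then show False using pos_def_mult_eq_0[OF pd] by (metis axis_eq_0_iff zero_neq_one)
  qed
  then have L: "L > 0" using L0 by simp
  have \<mu>: "\<mu> > 0" unfolding \<mu>_def by (rule lambda_min_pos[OF pd])
  have "\<mu> * (v \<bullet> v) \<le> v \<bullet> (A *v v)"
    unfolding \<mu>_def using lambda_min_rayleigh[of "sym_part A" v] pd
    by (simp add: sym_pos_def_def inner_sym_part)
  moreover have "(A *v v) \<bullet> (A *v v) \<le> L\<^sup>2 * (v \<bullet> v)"
  proof -
    have "norm (A *v v) \<le> L * norm v" unfolding L_def by (rule onorm[OF lin])
    then have "(norm (A *v v))\<^sup>2 \<le> (L * norm v)\<^sup>2" by (intro power_mono) simp_all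
    then show ?thesis by (simp add: dot_square_norm power_mult_distrib)
  qed
  moreover define \<alpha> where "\<alpha> = \<mu> / L\<^sup>2"
  have \<alpha>: "\<alpha> > 0" using \<mu> L by (simp add: \<alpha>_def)
  have "(norm (v - \<alpha> *\<^sub>R (A *v v)))\<^sup>2
      = v \<bullet> v - 2 * \<alpha> * (v \<bullet> (A *v v)) + \<alpha>\<^sup>2 * ((A *v v) \<bullet> (A *v v))"
    unfolding dot_square_norm[symmetric]
    by (simp add: inner_diff_left inner_diff_right inner_commute power2_eq_square algebra_simps)
  ultimately have "(norm (v - \<alpha> *\<^sub>R (A *v v)))\<^sup>2
      \<le> v \<bullet> v - 2 * \<alpha> * (\<mu> * (v \<bullet> v)) + \<alpha>\<^sup>2 * (L\<^sup>2 * (v \<bullet> v))"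
    using \<alpha> by (smt (verit) mult_left_mono zero_le_power2)
  also have "\<dots> = (1 - \<mu>\<^sup>2 / L\<^sup>2) * (norm v)\<^sup>2"
    using L by (simp add: \<alpha>_def dot_square_norm field_simps power2_eq_square)
  finally have "sqrt ((norm (v - \<alpha> *\<^sub>R (A *v v)))\<^sup>2) \<le> sqrt ((1 - \<mu>\<^sup>2 / L\<^sup>2) * (norm v)\<^sup>2)"
    by (rule real_sqrt_le_mono)
  then show ?thesis by (simp add: \<alpha>_def real_sqrt_mult)
qed

text \<open>
  The argument of the root is nonnegative because the contraction bound holds for a nonzero
  vector, where a negative factor would contradict the nonnegativity of the norm.
\<close>
lemma convergence_factor_nonneg:
  fixes A :: "real^'n^'n"
  assumes "sym_pos_def (sym_part A)"
  shows "0 \<le> sqrt (1 - (lambda_min (sym_part A))\<^sup>2 / (onorm ((*v) A))\<^sup>2)"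
proof -
  have "0 \<le> sqrt (1 - (lambda_min (sym_part A))\<^sup>2 / (onorm ((*v) A))\<^sup>2) * norm (axis undefined 1 :: real^'n)"
    using richardson_contraction[OF assms, of "axis undefined 1"] by (rule order_trans[OF norm_ge_zero])
  then show ?thesis by (simp add: norm_axis_1)
qed

section \<open>Krylov spaces and the minimal residual\<close>

lemma subspace_krylov: "subspace (krylov A r m)"
  by (simp add: krylov_def)

lemma krylov_mono: "m \<le> k \<Longrightarrow> krylov A r m \<subseteq> krylov A r k"
  unfolding krylov_def by (intro span_mono image_mono) auto

lemma power_in_krylov: "i < m \<Longrightarrow> (((*v) A) ^^ i) r \<in> krylov A r m"
  unfolding krylov_def by (intro span_base) auto

lemma krylov_mult:
  assumes "z \<in> krylov A r m"
  shows "A *v z \<in> krylov A r (Suc m)"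
proof -
  have "(*v) A ` krylov A r m = span ((*v) A ` (\<lambda>i. (((*v) A) ^^ i) r) ` {..<m})"
    unfolding krylov_def by (rule linear_span_image[symmetric]) (rule matrix_vector_mul_linear)
  also have "\<dots> \<subseteq> krylov A r (Suc m)"
  proof (rule span_minimal[OF _ subspace_krylov], clarify)
    fix i assume "i < m"
    then show "A *v (((*v) A) ^^ i) r \<in> krylov A r (Suc m)"
      using power_in_krylov[of "Suc i" "Suc m" A r] by simp
  qed
  finally show ?thesis using assms by auto
qed

text \<open>
  This exhibits \<open>(1 - \<alpha> t)\<^sup>i\<close> as one of the residual polynomials over which GMRES minimizes.
\<close>
lemma richardson_power_krylov:
  "\<exists>z\<in>krylov A r i. ((\<lambda>v. v - \<alpha> *\<^sub>R (A *v v)) ^^ i) r = r - A *v z"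
proof (induction i)
  case 0
  show ?case by (auto simp: krylov_def)
next
  case (Suc i)
  then obtain z where z: "z \<in> krylov A r i" "((\<lambda>v. v - \<alpha> *\<^sub>R (A *v v)) ^^ i) r = r - A *v z" by blast
  let ?z = "z + \<alpha> *\<^sub>R r - \<alpha> *\<^sub>R (A *v z)"
  have "?z \<in> krylov A r (Suc i)"
    using krylov_mult[OF z(1)] krylov_mono[of i "Suc i" A r] z(1) power_in_krylov[of 0 "Suc i" A r]
    by (auto intro!: subspace_diff subspace_add subspace_scale subspace_krylov)
  moreover have "((\<lambda>v. v - \<alpha> *\<^sub>R (A *v v)) ^^ Suc i) r = r - A *v ?z"
    by (simp add: z(2) matrix_vector_mult_diff_distrib matrix_vector_right_distrib
        matrix_vector_mult_scaleR algebra_simps)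
  ultimately show ?case by blast
qed

lemma richardson_power_norm:
  fixes A :: "real^'n^'n"
  assumes pd: "sym_pos_def (sym_part A)"
  defines "\<mu> \<equiv> lambda_min (sym_part A)" and "L \<equiv> onorm ((*v) A)"
  shows "norm (((\<lambda>v. v - (\<mu> / L\<^sup>2) *\<^sub>R (A *v v)) ^^ i) r) \<le> sqrt (1 - \<mu>\<^sup>2 / L\<^sup>2) ^ i * norm r"
proof (induction i)
  case (Suc i)
  let ?T = "\<lambda>v. v - (\<mu> / L\<^sup>2) *\<^sub>R (A *v v)" and ?\<rho> = "sqrt (1 - \<mu>\<^sup>2 / L\<^sup>2)"
  have "norm ((?T ^^ Suc i) r) \<le> ?\<rho> * norm ((?T ^^ i) r)"
    using richardson_contraction[OF pd, of "(?T ^^ i) r"] by (simp add: \<mu>_def L_def)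
  also have "\<dots> \<le> ?\<rho> * (?\<rho> ^ i * norm r)"
    using Suc.IH convergence_factor_nonneg[OF pd] by (intro mult_left_mono) (simp_all add: \<mu>_def L_def)
  finally show ?case by simp
qed simp

text \<open>
  A Hessenberg relation raises the index by one, so each application of \<open>A\<close> needs one more
  basis vector. The family \<open>V\<close> is arbitrary, so that an Arnoldi basis may be padded with zero
  vectors.
\<close>
lemma power_in_span_basis:
  fixes A :: "real^'n^'n"
  assumes "r \<in> span {V 0}"
    and step: "\<And>j. j < m \<Longrightarrow> A *v V j \<in> span (V ` {..Suc j})"
    and "i \<le> m"
  shows "(((*v) A) ^^ i) r \<in> span (V ` {..i})"
  using \<open>i \<le> m\<close>
proof (induction i)
  case 0
  then show ?case using assms(1) by simp
next
  case (Suc i)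
  have "(*v) A ` span (V ` {..i}) = span ((*v) A ` V ` {..i})"
    by (rule linear_span_image[symmetric]) (rule matrix_vector_mul_linear)
  also have "\<dots> \<subseteq> span (V ` {..Suc i})"
  proof (rule span_minimal[OF _ subspace_span], clarify)
    fix j assume "j \<le> i"
    then have "A *v V j \<in> span (V ` {..Suc j})" using step Suc.prems by simp
    moreover have "span (V ` {..Suc j}) \<subseteq> span (V ` {..Suc i})"
      using \<open>j \<le> i\<close> by (intro span_mono image_mono) auto
    ultimately show "A *v V j \<in> span (V ` {..Suc i})" by blast
  qed
  finally show ?case using Suc by auto
qed

lemma arnoldi_decomposition_dim_pos:
  fixes A :: "real^'n^'n"
  assumes "arnoldi_decomposition A r l d m V H" "r \<noteq> 0"
  shows "0 < d"
proof (rule ccontr)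
  assume "\<not> 0 < d"
  then have "krylov A r (l + 1) = {0}"
    using assms(1) by (auto simp: arnoldi_decomposition_def)
  then show False using power_in_krylov[of 0 "l + 1" A r] assms(2) by simp
qed

text \<open>
  If the process breaks down, all of the Krylov space is spanned by the \<open>d \<le> l\<close> basis vectors.
  Otherwise only the last of the \<open>l + 1\<close> basis vectors has to be left out, and the Hessenberg
  structure shows that the powers below \<open>l\<close> do not involve it.
\<close>
lemma arnoldi_decomposition_krylov:
  fixes A :: "real^'n^'n"
  assumes dec: "arnoldi_decomposition A r l d m V H" and r: "r \<noteq> 0"
  shows "krylov A r l \<subseteq> span (V ` {..<m})"
proof (cases "d \<le> l")
  case True
  then show ?thesis using dec krylov_mono[of l "l + 1" A r]
    by (auto simp: arnoldi_decomposition_def min_absorb2)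
next
  case False
  then have m: "m = l" "m < d" using dec by (auto simp: arnoldi_decomposition_def)
  have "A *v V j \<in> span (V ` {..Suc j})" if "j < m" for j
  proof -
    have "A *v V j = (\<Sum>i<d. H i j *\<^sub>R V i)"
      using dec that by (simp add: arnoldi_decomposition_def)
    also have "\<dots> = (\<Sum>i\<in>{..Suc j}. H i j *\<^sub>R V i)"
      using dec that m by (intro sum.mono_neutral_right) (auto simp: arnoldi_decomposition_def)
    also have "\<dots> \<in> span (V ` {..Suc j})"
      by (intro span_sum span_scale span_base) auto
    finally show ?thesis .
  qed
  moreover have "r \<in> span {V 0}"
  proof -
    have "r = norm r *\<^sub>R V 0" using dec r by (simp add: arnoldi_decomposition_def)
    then show ?thesis by (metis insertI1 span_base span_scale)
  qed
  ultimately have "(((*v) A) ^^ i) r \<in> span (V ` {..i})" if "i \<le> m" for i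
    using power_in_span_basis that by blast
  moreover have "span (V ` {..i}) \<subseteq> span (V ` {..<m})" if "i < m" for i
    using that by (intro span_mono image_mono) auto
  ultimately have "(((*v) A) ^^ i) r \<in> span (V ` {..<m})" if "i < m" for i
    using that by (meson less_imp_le subsetD)
  then show ?thesis
    unfolding krylov_def m(1)[symmetric] by (intro span_minimal subspace_span) auto
qed

text \<open>
  Since \<open>r = \<beta> V\<^sub>0\<close> and \<open>A V = V H\<close>, the vector \<open>\<beta> e\<^sub>1 - H y\<close> holds the coordinates of the new residual
  in the orthonormal basis, and so has the same norm.
\<close>
lemma ls_objective_eq_residual:
  fixes A :: "real^'n^'n"
  assumes dec: "arnoldi_decomposition A r l d m V H" and r: "r \<noteq> 0"
  shows "ls_objective d m (norm r) H y = (norm (r - A *v (\<Sum>j<m. y j *\<^sub>R V j)))\<^sup>2"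
proof -
  let ?f = "\<lambda>i. (if i = 0 then norm r else 0) - (\<Sum>j<m. H i j * y j)"
  have d: "0 < d" using arnoldi_decomposition_dim_pos[OF assms] .
  have orth: "V i \<bullet> V j = (if i = j then 1 else 0)" if "i < d" "j < d" for i j
    using dec that by (simp add: arnoldi_decomposition_def)
  have "A *v (\<Sum>j<m. y j *\<^sub>R V j) = (\<Sum>j<m. \<Sum>i<d. (H i j * y j) *\<^sub>R V i)"
    using dec by (simp add: arnoldi_decomposition_def matrix_vector_right_distrib
        linear_sum[OF matrix_vector_mul_linear] matrix_vector_mult_scaleR scaleR_sum_right mult.commute)
  also have "\<dots> = (\<Sum>i<d. (\<Sum>j<m. H i j * y j) *\<^sub>R V i)"
    by (subst sum.swap) (simp add: scaleR_sum_left)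
  finally have *: "A *v (\<Sum>j<m. y j *\<^sub>R V j) = (\<Sum>i<d. (\<Sum>j<m. H i j * y j) *\<^sub>R V i)" .
  have "r = norm r *\<^sub>R V 0" using dec r by (simp add: arnoldi_decomposition_def)
  also have "\<dots> = (\<Sum>i<d. (if i = 0 then norm r else 0) *\<^sub>R V i)"
    using d by (simp add: if_distrib[of "\<lambda>t. t *\<^sub>R _"] sum.delta cong: if_cong)
  finally have "r - A *v (\<Sum>j<m. y j *\<^sub>R V j) = (\<Sum>i<d. ?f i *\<^sub>R V i)"
    using * by (simp add: sum_subtractf scaleR_left_diff_distrib)
  moreover have "(norm (\<Sum>i<d. ?f i *\<^sub>R V i))\<^sup>2 = (\<Sum>i<d. \<Sum>j<d. ?f i * (?f j * (V j \<bullet> V i)))"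
    by (simp only: dot_square_norm[symmetric] inner_sum_left inner_sum_right inner_scaleR_left inner_scaleR_right sum_distrib_left)
  moreover have "\<dots> = (\<Sum>i<d. \<Sum>j<d. if i = j then (?f i)\<^sup>2 else 0)"
    using orth by (intro sum.cong refl) (simp add: power2_eq_square)
  ultimately show ?thesis by (simp add: ls_objective_def)
qed

lemma residual_add: "residual A b (x + z) = residual A b x - A *v z"
  by (simp add: residual_def matrix_vector_right_distrib)

lemma span_image_lessThan_sum:
  assumes "z \<in> span (V ` {..<m::nat})"
  shows "\<exists>y. z = (\<Sum>j<m. y j *\<^sub>R V j)"
  using assms
proof (induction rule: span_induct_alt)
  case base
  show ?case by (rule exI[of _ "\<lambda>_. 0"]) simp
next
  case (step c v z)
  then obtain i y where iy: "i < m" "v = V i" "z = (\<Sum>j<m. y j *\<^sub>R V j)" by auto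
  have "c *\<^sub>R v = (\<Sum>j<m. (if j = i then c else 0) *\<^sub>R V j)"
    using iy by (simp add: if_distrib[of "\<lambda>t. t *\<^sub>R _"] sum.delta cong: if_cong)
  then show ?case using iy
    by (intro exI[of _ "\<lambda>j. (if j = i then c else 0) + y j"]) (simp add: scaleR_left_distrib sum.distrib)
qed

lemma gmres_step_optimal:
  fixes A :: "real^'n^'n"
  assumes step: "gmres_step A b l x x'" and z: "z \<in> krylov A (residual A b x) l"
  shows "norm (residual A b x') \<le> norm (residual A b x - A *v z)"
proof (cases "residual A b x = 0")
  case True
  then show ?thesis using step by (simp add: gmres_step_def)
next
  case False
  let ?r = "residual A b x"
  from step False obtain d m V H y where dec: "arnoldi_decomposition A ?r l d m V H"
    and min: "is_arg_min (ls_objective d m (norm ?r) H) (\<lambda>_. True) y"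
    and x': "x' = x + (\<Sum>j<m. y j *\<^sub>R V j)"
    by (auto simp: gmres_step_def)
  obtain y' where y': "z = (\<Sum>j<m. y' j *\<^sub>R V j)"
    using span_image_lessThan_sum arnoldi_decomposition_krylov[OF dec False] z by blast
  have "ls_objective d m (norm ?r) H y \<le> ls_objective d m (norm ?r) H y'"
    using min by (auto simp: is_arg_min_def not_less)
  then have "(norm (residual A b x'))\<^sup>2 \<le> (norm (?r - A *v z))\<^sup>2"
    unfolding ls_objective_eq_residual[OF dec False] x' residual_add y' .
  then show ?thesis by simp
qed

lemma gmres_step_contraction:
  fixes A :: "real^'n^'n"
  assumes pd: "sym_pos_def (sym_part A)" and step: "gmres_step A b l x x'"
  shows "norm (residual A b x')
    \<le> sqrt (1 - (lambda_min (sym_part A))\<^sup>2 / (onorm ((*v) A))\<^sup>2) ^ l * norm (residual A b x)"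
proof -
  let ?r = "residual A b x" and ?\<alpha> = "lambda_min (sym_part A) / (onorm ((*v) A))\<^sup>2"
  obtain z where z: "z \<in> krylov A ?r l" "((\<lambda>v. v - ?\<alpha> *\<^sub>R (A *v v)) ^^ l) ?r = ?r - A *v z"
    using richardson_power_krylov by blast
  have "norm (residual A b x') \<le> norm (?r - A *v z)"
    by (rule gmres_step_optimal[OF step z(1)])
  also have "\<dots> \<le> sqrt (1 - (lambda_min (sym_part A))\<^sup>2 / (onorm ((*v) A))\<^sup>2) ^ l * norm ?r"
    unfolding z(2)[symmetric] by (rule richardson_power_norm[OF pd])
  finally show ?thesis .
qed

lemma gmres_convergence:
  fixes A :: "real^'n^'n" and x :: "nat \<Rightarrow> real^'n"
  assumes pd: "sym_pos_def (sym_part A)"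
    and steps: "\<forall>i<k. gmres_step A b l (x i) (x (Suc i))"
  shows "norm (residual A b (x k))
    \<le> sqrt (1 - (lambda_min (sym_part A))\<^sup>2 / (onorm ((*v) A))\<^sup>2) ^ (k * l) * norm (residual A b (x 0))"
  using steps
proof (induction k)
  case (Suc k)
  let ?\<rho> = "sqrt (1 - (lambda_min (sym_part A))\<^sup>2 / (onorm ((*v) A))\<^sup>2)"
  have "norm (residual A b (x (Suc k))) \<le> ?\<rho> ^ l * norm (residual A b (x k))"
    using gmres_step_contraction[OF pd] Suc.prems by blast
  also have "\<dots> \<le> ?\<rho> ^ l * (?\<rho> ^ (k * l) * norm (residual A b (x 0)))"
    using Suc convergence_factor_nonneg[OF pd] by (intro mult_left_mono) auto
  finally show ?case by (simp add: power_add mult.assoc)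
qed simp

section \<open>Linear combinations and orthonormal lists\<close>

text \<open>
  The coefficients form a list, as in the computation, while the vectors form a function, so that
  a basis can be re-indexed, transformed or padded without changing list lengths.
\<close>
definition lincomb :: "real list \<Rightarrow> (nat \<Rightarrow> 'a::real_vector) \<Rightarrow> 'a" where
  "lincomb xs Q = (\<Sum>i<length xs. xs ! i *\<^sub>R Q i)"

lemma lincomb_Nil [simp]: "lincomb [] Q = 0"
  by (simp add: lincomb_def)

lemma lincomb_Cons: "lincomb (x # xs) Q = x *\<^sub>R Q 0 + lincomb xs (\<lambda>i. Q (Suc i))"
  by (simp add: lincomb_def sum.lessThan_Suc_shift del: sum.lessThan_Suc)

lemma lincomb_snoc: "lincomb (xs @ [x]) Q = lincomb xs Q + x *\<^sub>R Q (length xs)"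
  by (simp add: lincomb_def nth_append)

lemma lincomb_butlast_last:
  assumes "length xs = Suc n"
  shows "lincomb xs Q = lincomb (butlast xs) Q + last xs *\<^sub>R Q n"
proof -
  have "xs = butlast xs @ [last xs]" using assms by (metis append_butlast_last_id list.size(3) nat.distinct(1))
  moreover have "length (butlast xs) = n" using assms by simp
  ultimately show ?thesis by (metis lincomb_snoc)
qed

lemma lincomb_cong:
  assumes "xs = ys" "\<And>i. i < length ys \<Longrightarrow> P i = Q i"
  shows "lincomb xs P = lincomb ys Q"
  using assms by (simp add: lincomb_def)

lemma inner_lincomb_eq_0:
  assumes "\<And>i. i < length xs \<Longrightarrow> v \<bullet> Q i = 0"
  shows "v \<bullet> lincomb xs Q = 0"
  using assms by (simp add: lincomb_def inner_sum_right)

lemma matrix_mult_lincomb: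
  fixes A :: "real^'n^'n"
  shows "A *v lincomb xs Q = lincomb xs (\<lambda>i. A *v Q i)"
  by (simp add: lincomb_def linear_sum[OF matrix_vector_mul_linear] matrix_vector_mult_scaleR)

definition orthonormal :: "('a::real_inner) list \<Rightarrow> bool" where
  "orthonormal vs \<longleftrightarrow> (\<forall>v\<in>set vs. v \<bullet> v = 1) \<and> sorted_wrt (\<lambda>u v. u \<bullet> v = 0) vs"

lemma orthonormal_nth:
  assumes "orthonormal vs" "i < length vs" "j < length vs"
  shows "vs ! i \<bullet> vs ! j = (if i = j then 1 else 0)"
proof -
  have "vs ! i \<bullet> vs ! j = 0" if "i < j" "j < length vs" for i j
    using assms(1) that by (auto simp: orthonormal_def sorted_wrt_iff_nth_less)
  moreover from this have "vs ! j \<bullet> vs ! i = 0" if "i < j" "j < length vs" for i j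
    using that by (metis inner_commute)
  ultimately show ?thesis
    using assms by (cases i j rule: linorder_cases) (auto simp: orthonormal_def)
qed

lemma dim_span_orthonormal:
  fixes vs :: "'a::euclidean_space list"
  assumes "orthonormal vs"
  shows "dim (span (set vs)) = length vs"
proof -
  have "inj_on (nth vs) {..<length vs}"
    by (rule inj_onI) (metis orthonormal_nth[OF assms] lessThan_iff zero_neq_one)
  then have "card (set vs) = length vs"
    by (metis card_image card_lessThan lessThan_atLeast0 list.set_map map_nth set_upt)
  moreover have "pairwise orthogonal (set vs)"
    using orthonormal_nth[OF assms] by (auto simp: pairwise_def orthogonal_def in_set_conv_nth)
  moreover have "0 \<notin> set vs" using assms by (force simp: orthonormal_def)
  ultimately show ?thesis
    by (simp add: dim_eq_card_independent pairwise_orthogonal_independent)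
qed

section \<open>The Arnoldi process\<close>

lemmas counted_simps = bind_counted_def ret_def op_mul_def op_div_def op_sqrt_def op_fma_def
  op_dot_def op_axpy_def op_vdiv_def op_norm_def op_matvec_def

text \<open>
  Modified Gram-Schmidt takes each coefficient from the partly reduced vector. Subtracting
  multiples of the later basis vectors keeps what was achieved, since these are orthogonal to the
  earlier ones.
\<close>
lemma orthogonalize_correct:
  fixes vs :: "(real^'n) list"
  assumes "orthogonalize vs w = ((h, u), cost)" "orthonormal vs"
  shows "length h = length vs \<and> w = lincomb h (\<lambda>i. vs ! i) + u \<and> (\<forall>v\<in>set vs. v \<bullet> u = 0)
    \<and> cost = 2 * real CARD('n) * real (length vs)"
  using assms
proof (induction vs arbitrary: w h u cost)
  case Nil
  then show ?case by (simp add: ret_def)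
next
  case (Cons v vs)
  define w' where "w' = w - (v \<bullet> w) *\<^sub>R v"
  obtain h' cost' where rec: "orthogonalize vs w' = ((h', u), cost')"
    and h: "h = (v \<bullet> w) # h'" and cost: "cost = 2 * real CARD('n) + cost'"
    using Cons.prems(1) by (auto simp: counted_simps w'_def split_beta algebra_simps prod_eq_iff)
  have on: "orthonormal vs" "v \<bullet> v = 1" "\<forall>x\<in>set vs. v \<bullet> x = 0"
    using Cons.prems(2) by (auto simp: orthonormal_def)
  note IH = Cons.IH[OF rec on(1)]
  have "v \<bullet> w' = 0" by (simp add: w'_def inner_diff_right on(2))
  moreover have "v \<bullet> lincomb h' (\<lambda>i. vs ! i) = 0"
    using IH on(3) by (intro inner_lincomb_eq_0) simp
  ultimately have "v \<bullet> u = 0" using IH by (metis add_0 inner_add_right)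
  moreover have "w = lincomb h (\<lambda>i. (v # vs) ! i) + u"
    using IH by (simp add: h lincomb_Cons w'_def) (metis add.commute add.assoc diff_add_cancel)
  ultimately show ?case using IH by (simp add: h cost algebra_simps)
qed

text \<open>
  The invariant covers a running process, where there is one more basis vector than there are
  columns, and a broken-down one, where the numbers agree. In the second case the last column
  has one entry too many; padding the basis with the zero vector gives this entry, which is zero,
  a partner. The last entry of a column is zero exactly at the breakdown.
\<close>
definition arnoldi_inv ::
    "real^'n^'n \<Rightarrow> real^'n \<Rightarrow> (real^'n) list \<Rightarrow> (real^'n) list \<Rightarrow> real list list \<Rightarrow> bool" where
  "arnoldi_inv A v V W H \<longleftrightarrow>
     V \<noteq> [] \<and> V ! 0 = v \<and> orthonormal V \<and>
     length H \<le> length V \<and> length V \<le> Suc (length H) \<and>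
     W = map ((*v) A) (take (length H) V) \<and>
     (\<forall>j<length H. length (H ! j) = Suc (Suc j) \<and>
        A *v (V ! j) = lincomb (H ! j) (nth_default 0 V) \<and>
        (last (H ! j) \<noteq> 0 \<longleftrightarrow> Suc j < length V))"

lemma arnoldi_inv_init:
  assumes "v \<bullet> v = 1"
  shows "arnoldi_inv A v [v] [] []"
  using assms by (simp add: arnoldi_inv_def orthonormal_def)

lemma map_butlast_last:
  assumes "length xs = Suc k"
  shows "map f xs = map f (take k xs) @ [f (last xs)]"
proof -
  have "xs = take k xs @ [last xs]"
    using assms by (metis append_butlast_last_id butlast_conv_take diff_Suc_1 list.size(3) nat.distinct(1))
  then show ?thesis by (metis list.simps(8) list.simps(9) map_append)
qed

lemma arnoldi_inv_breakdown:
  assumes inv: "arnoldi_inv A v V W H" and len: "length V = Suc (length H)"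
    and h: "length h = length V" and col: "A *v last V = lincomb h (\<lambda>i. V ! i)"
  shows "arnoldi_inv A v V (W @ [A *v last V]) (H @ [h @ [0]])"
proof -
  have "map ((*v) A) V = map ((*v) A) (take (length H) V) @ [A *v last V]"
    by (rule map_butlast_last[OF len])
  moreover have "last V = V ! length H" using len by (cases "V = []") (simp_all add: last_conv_nth)
  moreover have "lincomb h (\<lambda>i. V ! i) = lincomb (h @ [0]) (nth_default 0 V)"
    by (simp add: lincomb_snoc) (rule lincomb_cong, simp_all add: h nth_default_nth)
  ultimately show ?thesis
    using inv len h col
    by (auto simp: arnoldi_inv_def nth_append less_Suc_eq take_Suc_conv_app_nth)
qed

lemma arnoldi_inv_extend:
  assumes inv: "arnoldi_inv A v V W H" and len: "length V = Suc (length H)"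
    and h: "length h = length V" and col: "A *v last V = lincomb h (\<lambda>i. V ! i) + \<eta> *\<^sub>R q"
    and \<eta>: "\<eta> \<noteq> 0" and q: "q \<bullet> q = 1" "\<forall>x\<in>set V. x \<bullet> q = 0"
  shows "arnoldi_inv A v (V @ [q]) (W @ [A *v last V]) (H @ [h @ [\<eta>]])"
proof -
  have last: "last V = V ! length H" using len by (cases "V = []") (simp_all add: last_conv_nth)
  have mapV: "map ((*v) A) V = map ((*v) A) (take (length H) V) @ [A *v last V]"
    by (rule map_butlast_last[OF len])
  have newcol: "A *v (V ! length H) = lincomb (h @ [\<eta>]) (nth_default 0 (V @ [q]))"
  proof -
    have "lincomb h (\<lambda>i. V ! i) = lincomb h (nth_default 0 (V @ [q]))"
      by (rule lincomb_cong) (simp_all add: h nth_default_nth nth_append)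
    then show ?thesis using col last by (simp add: lincomb_snoc h nth_default_nth)
  qed
  have oldcol: "lincomb (H ! j) (nth_default 0 (V @ [q])) = lincomb (H ! j) (nth_default 0 V)"
    if "j < length H" for j
    using inv len that by (intro lincomb_cong) (auto simp: arnoldi_inv_def nth_default_nth nth_append)
  have "orthonormal (V @ [q])"
    using inv q by (auto simp: arnoldi_inv_def orthonormal_def sorted_wrt_append)
  then show ?thesis
    using inv len h newcol \<eta> last mapV
    by (auto simp: arnoldi_inv_def nth_append less_Suc_eq take_Suc_conv_app_nth oldcol)
qed

text \<open>
  The step that treats column \<open>p\<close>, counted from \<open>0\<close>, costs one matrix-vector product,
  \<open>2 n (p + 1)\<close> for the orthogonalization, and \<open>n + 1\<close> for the norm of what remains. These sum to
  the potential \<open>\<Phi>\<close>, which is evaluated at the numbers of columns before and after. The term with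
  the lengths of the bases counts the normalizations, of which a breakdown saves one.
\<close>
lemma arnoldi_correct:
  fixes A :: "real^'n^'n" and \<gamma> :: real
  defines "\<Phi> \<equiv> \<lambda>p. real p * cost_Mv \<gamma> A + real CARD('n) * (real p * (real p + 2)) + real p"
  assumes "arnoldi \<gamma> A k V W H = ((V', W', H'), cost)" "arnoldi_inv A v V W H"
    and "length V = Suc (length H)"
  shows "arnoldi_inv A v V' W' H'
    \<and> (length V' = Suc (length H') \<and> length H' = length H + k
        \<or> length V' = length H' \<and> length H' \<le> length H + k)
    \<and> cost = \<Phi> (length H') - \<Phi> (length H) + real CARD('n) * (real (length V') - real (length V))"
  using assms(2-)
proof (induction k arbitrary: V W H cost)
  case 0
  then show ?case by (simp add: ret_def)
next
  case (Suc k)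
  obtain h u ocost where ortho: "orthogonalize V (A *v last V) = ((h, u), ocost)"
    by (metis surj_pair)
  have on: "orthonormal V" using Suc.prems(2) by (simp add: arnoldi_inv_def)
  note oc = orthogonalize_correct[OF ortho on]
  define \<eta> where "\<eta> = sqrt (u \<bullet> u)"
  define q where "q = (1 / \<eta>) *\<^sub>R u"
  show ?case
  proof (cases "\<eta> = 0")
    case True
    then have u: "u = 0" by (simp add: \<eta>_def)
    have res: "V' = V" "W' = W @ [A *v last V]" "H' = H @ [h @ [0]]"
      and cost: "cost = cost_Mv \<gamma> A + ocost + real CARD('n) + 1"
      using Suc.prems(1) u by (auto simp: counted_simps ortho)
    have "arnoldi_inv A v V' W' H'"
      unfolding res using arnoldi_inv_breakdown[OF Suc.prems(2,3), of h] oc u by simp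
    moreover have "ocost = 2 * real CARD('n) * real (length V)" using oc by simp
    ultimately show ?thesis using Suc.prems(3)
      by (simp add: res cost \<Phi>_def algebra_simps)
  next
    case False
    then have u: "u \<noteq> 0" by (simp add: \<eta>_def)
    obtain cost' where rec: "arnoldi \<gamma> A k (V @ [q]) (W @ [A *v last V]) (H @ [h @ [\<eta>]]) = ((V', W', H'), cost')"
      and cost: "cost = cost_Mv \<gamma> A + ocost + 2 * real CARD('n) + 1 + cost'"
      using Suc.prems(1) False u
      by (auto simp: counted_simps ortho \<eta>_def[symmetric] q_def prod_eq_iff)
    have "q \<bullet> q = 1"
    proof -
      have "q \<bullet> q = (u \<bullet> u) / \<eta>\<^sup>2" by (simp add: q_def power2_eq_square)
      also have "\<dots> = 1" using u by (simp add: \<eta>_def)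
      finally show ?thesis .
    qed
    moreover have "\<eta> *\<^sub>R q = u" using False by (simp add: q_def)
    moreover have "\<forall>x\<in>set V. x \<bullet> q = 0" using oc by (simp add: q_def)
    ultimately have inv: "arnoldi_inv A v (V @ [q]) (W @ [A *v last V]) (H @ [h @ [\<eta>]])"
      using oc False by (intro arnoldi_inv_extend[OF Suc.prems(2,3)]) auto
    have "ocost = 2 * real CARD('n) * real (length V)" using oc by simp
    then show ?thesis using Suc.IH[OF rec inv] Suc.prems(3)
      by (auto simp: cost \<Phi>_def algebra_simps)
  qed
qed

section \<open>Givens rotations and back substitution\<close>

lemma reduce_column_length:
  assumes "reduce_column G h = ((rs, g), cost)" "length h = Suc (Suc (length G))"
  shows "length rs = Suc (length G)" "cost = 4 * real (length G) + 5"
proof -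
  have "length rs = Suc (length G) \<and> cost = 4 * real (length G) + 5"
    using assms
  proof (induction G h arbitrary: rs g cost rule: reduce_column.induct)
    case (2 c s G a b h)
    then show ?case by (auto simp: counted_simps split_beta prod_eq_iff)
  qed (auto simp: counted_simps)
  then show "length rs = Suc (length G)" "cost = 4 * real (length G) + 5" by auto
qed

text \<open>
  The subdiagonal entry reaches the final rotation unchanged. A nonzero one therefore forces a
  nonzero pivot, and the rotation is a genuine one if the pivot is nonzero.
\<close>
lemma reduce_column_pivot:
  assumes "reduce_column G h = ((rs, c, s), cost)" "length h = Suc (Suc (length G))"
  shows "(last h \<noteq> 0 \<longrightarrow> last rs \<noteq> 0) \<and> (last h = 0 \<longrightarrow> s = 0) \<and> (last rs \<noteq> 0 \<longrightarrow> c\<^sup>2 + s\<^sup>2 = 1)"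
  using assms
proof (induction G h arbitrary: rs c s cost rule: reduce_column.induct)
  case (1 a b h)
  define p where "p = a * a + b * b"
  have eqs: "h = []" "rs = [sqrt p]" "c = a / sqrt p" "s = b / sqrt p"
    using 1 by (auto simp: counted_simps p_def)
  have p: "p \<ge> 0" "b \<noteq> 0 \<Longrightarrow> p \<noteq> 0"
    by (auto simp: p_def sum_squares_eq_zero_iff)
  have "c\<^sup>2 + s\<^sup>2 = 1" if "p \<noteq> 0"
  proof -
    have "c\<^sup>2 + s\<^sup>2 = p / (sqrt p)\<^sup>2"
      unfolding eqs p_def by (simp only: power_divide add_divide_distrib power2_eq_square
          times_divide_times_eq)
    then show ?thesis using that p(1) by simp
  qed
  then show ?case using p(2) by (auto simp: eqs)
next
  case (2 c0 s0 G a b h)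
  let ?h = "(c0 * b - s0 * a) # h"
  obtain rs' cost' where rec: "reduce_column G ?h = ((rs', c, s), cost')"
    and rs: "rs = (c0 * a + s0 * b) # rs'"
    using 2(2) by (auto simp: counted_simps split_beta prod_eq_iff)
  have len: "length ?h = Suc (Suc (length G))" using 2(3) by simp
  have "rs' \<noteq> []" using reduce_column_length(1)[OF rec len] by auto
  moreover have "h \<noteq> []" using len by auto
  ultimately show ?case using 2(1)[OF rec len] by (simp add: rs)
qed auto

lemma list_axpy_correct:
  "length xs = length zs \<Longrightarrow> length (fst (list_axpy a xs zs)) = length zs
    \<and> lincomb (fst (list_axpy a xs zs)) Q = a *\<^sub>R lincomb xs Q + lincomb zs Q
    \<and> snd (list_axpy a xs zs) = real (length zs)"
proof (induction xs zs arbitrary: Q rule: list_induct2)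
  case (Cons x xs z zs)
  then show ?case by (simp add: counted_simps lincomb_Cons algebra_simps)
qed (simp add: ret_def)

text \<open>
  Solving the triangular system is expressed through arbitrary vectors \<open>Q\<close>: if the columns of the
  triangular factor are coordinates with respect to \<open>Q\<close>, the computed combination of them has
  the coordinates \<open>g\<close>. The pass over the last column removes the component along the last vector.
\<close>
lemma back_substitution_correct:
  assumes "back_substitution (rev R) g ys = (zs, cost)" "length g = length R"
    and "\<And>j. j < length R \<Longrightarrow> length (R ! j) = Suc j" "\<And>j. j < length R \<Longrightarrow> last (R ! j) \<noteq> 0"
  shows "\<exists>y. zs = y @ ys \<and> length y = length R
    \<and> (\<forall>Q :: nat \<Rightarrow> 'a::real_vector. lincomb y (\<lambda>j. lincomb (R ! j) Q) = lincomb g Q)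
    \<and> cost = real (length R) * (real (length R) + 1) / 2"
  using assms
proof (induction R arbitrary: g ys cost rule: rev_induct)
  case Nil
  then show ?case by (simp add: ret_def)
next
  case (snoc rs R)
  define y where "y = last g / last rs"
  define g' where "g' = fst (list_axpy (- y) (butlast rs) (butlast g))"
  have rs: "length rs = Suc (length R)" "last rs \<noteq> 0"
    using snoc.prems(3)[of "length R"] snoc.prems(4)[of "length R"] by simp_all
  have g: "length g = Suc (length R)" using snoc.prems(2) by simp
  have axpy: "length g' = length R \<and> lincomb g' Q = (- y) *\<^sub>R lincomb (butlast rs) Q + lincomb (butlast g) Q
    \<and> snd (list_axpy (- y) (butlast rs) (butlast g)) = real (length R)" for Q :: "nat \<Rightarrow> 'a"
    unfolding g'_def using list_axpy_correct[of "butlast rs" "butlast g" "- y" Q] rs g by simp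
  have axpy_cost: "snd (list_axpy (- y) (butlast rs) (butlast g)) = real (length R)"
    using axpy by blast
  obtain cost' where rec: "back_substitution (rev R) g' (y # ys) = (zs, cost')"
    and cost: "cost = 1 + real (length R) + cost'"
    using snoc.prems(1) axpy_cost by (auto simp: counted_simps y_def[symmetric] g'_def[symmetric] prod_eq_iff)
  have R: "length (R ! j) = Suc j" "last (R ! j) \<noteq> 0" if "j < length R" for j
    using snoc.prems(3,4)[of j] that by (simp_all add: nth_append)
  obtain y' where y': "zs = y' @ y # ys" "length y' = length R"
    "\<And>Q :: nat \<Rightarrow> 'a. lincomb y' (\<lambda>j. lincomb (R ! j) Q) = lincomb g' Q"
    "cost' = real (length R) * (real (length R) + 1) / 2"
    using snoc.IH[OF rec _ R] axpy by blast
  have "lincomb (y' @ [y]) (\<lambda>j. lincomb ((R @ [rs]) ! j) Q) = lincomb g Q" for Q :: "nat \<Rightarrow> 'a"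
  proof -
    have "lincomb (y' @ [y]) (\<lambda>j. lincomb ((R @ [rs]) ! j) Q) = lincomb g' Q + y *\<^sub>R lincomb rs Q"
      unfolding lincomb_snoc y'(3)[symmetric]
      by (simp add: y'(2)) (rule lincomb_cong, simp_all add: nth_append y'(2))
    also have "\<dots> = lincomb (butlast g) Q + (y * last rs) *\<^sub>R Q (length R)"
      using axpy[of Q] lincomb_butlast_last[OF rs(1), of Q] by (simp add: algebra_simps)
    also have "\<dots> = lincomb g Q"
      using lincomb_butlast_last[OF g, of Q] rs(2) by (simp add: y_def)
    finally show ?thesis .
  qed
  then show ?case using y' by (intro exI[of _ "y' @ [y]"]) (simp add: cost field_simps)
qed

text \<open>
  Records the rotations \<open>F\<close> and the successive values \<open>t\<close> of the last entry of the right-hand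
  side, neither of which the computation returns.
\<close>
lemma givens_qr_rotations:
  assumes "givens_qr G \<tau> Hs = ((R, g), cost)"
    and "\<And>j. j < length Hs \<Longrightarrow> length (Hs ! j) = Suc (Suc (length G + j))"
  shows "\<exists>F t. length F = length Hs \<and> length R = length Hs \<and> length g = length Hs \<and> t 0 = \<tau>
    \<and> (\<forall>j<length Hs. fst (reduce_column (G @ take j F) (Hs ! j)) = (R ! j, F ! j)
        \<and> g ! j = fst (F ! j) * t j \<and> t (Suc j) = - snd (F ! j) * t j)
    \<and> cost = 2 * (real (length Hs))\<^sup>2 + 5 * real (length Hs) + 4 * real (length G) * real (length Hs)"
  using assms
proof (induction Hs arbitrary: G \<tau> R g cost)
  case Nil
  then show ?case by (auto simp: ret_def)
next
  case (Cons h Hs)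
  obtain rs c s rcost where red: "reduce_column G h = ((rs, c, s), rcost)"
    by (metis surj_pair)
  have rcost: "rcost = 4 * real (length G) + 5"
    using reduce_column_length(2)[OF red] Cons.prems(2)[of 0] by simp
  obtain R' g' cost' where rec: "givens_qr (G @ [(c, s)]) (- s * \<tau>) Hs = ((R', g'), cost')"
    by (metis surj_pair)
  have res: "R = rs # R'" "g = (c * \<tau>) # g'" "cost = rcost + 2 + cost'"
    using Cons.prems(1) rec by (auto simp: counted_simps red)
  have "length (Hs ! j) = Suc (Suc (length (G @ [(c, s)]) + j))" if "j < length Hs" for j
    using Cons.prems(2)[of "Suc j"] that by simp
  from Cons.IH[OF rec this] obtain F t where IH: "length F = length Hs" "length R' = length Hs"
    "length g' = length Hs" "t 0 = - s * \<tau>"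
    "\<And>j. j < length Hs \<Longrightarrow> fst (reduce_column (G @ (c, s) # take j F) (Hs ! j)) = (R' ! j, F ! j)
        \<and> g' ! j = fst (F ! j) * t j \<and> t (Suc j) = - snd (F ! j) * t j"
    "cost' = 2 * (real (length Hs))\<^sup>2 + 5 * real (length Hs) + 4 * real (length (G @ [(c, s)])) * real (length Hs)"
    by auto
  show ?case
  proof (intro exI conjI allI impI)
    let ?F = "(c, s) # F" and ?t = "case_nat \<tau> t"
    show "cost = 2 * (real (length (h # Hs)))\<^sup>2 + 5 * real (length (h # Hs))
      + 4 * real (length G) * real (length (h # Hs))"
      by (simp add: res rcost IH(6) power2_eq_square algebra_simps)
    fix j assume "j < length (h # Hs)"
    then show "fst (reduce_column (G @ take j ?F) ((h # Hs) ! j)) = (R ! j, ?F ! j)"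
      "g ! j = fst (?F ! j) * ?t j" "?t (Suc j) = - snd (?F ! j) * ?t j"
      using IH(4,5) by (cases j; simp add: res red)+
  qed (simp_all add: IH res)
qed

section \<open>Rotated bases\<close>

text \<open>
  A rotation of the rows \<open>j\<close> and \<open>j + 1\<close> of the Hessenberg matrix is the same as a rotation of the
  basis vectors that these rows refer to. The vector carried to position \<open>j\<close> and the next basis
  vector are turned into a settled vector, which no later rotation touches, and a vector carried
  on to position \<open>j + 1\<close>.
\<close>
primrec carried :: "(real \<times> real) list \<Rightarrow> (nat \<Rightarrow> 'a::real_vector) \<Rightarrow> nat \<Rightarrow> 'a" where
  "carried G V 0 = V 0"
| "carried G V (Suc j) = fst (G ! j) *\<^sub>R V (Suc j) - snd (G ! j) *\<^sub>R carried G V j"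

definition settled :: "(real \<times> real) list \<Rightarrow> (nat \<Rightarrow> 'a::real_vector) \<Rightarrow> nat \<Rightarrow> 'a" where
  "settled G V j = fst (G ! j) *\<^sub>R carried G V j + snd (G ! j) *\<^sub>R V (Suc j)"

text \<open>
  This and the next lemma apply the inverse rotation, which expresses the two old vectors by the
  two new ones.
\<close>
lemma carried_split:
  assumes "(fst (G ! j))\<^sup>2 + (snd (G ! j))\<^sup>2 = 1"
  shows "carried G V j = fst (G ! j) *\<^sub>R settled G V j - snd (G ! j) *\<^sub>R carried G V (Suc j)"
proof -
  have "fst (G ! j) *\<^sub>R settled G V j - snd (G ! j) *\<^sub>R carried G V (Suc j)
      = ((fst (G ! j))\<^sup>2 + (snd (G ! j))\<^sup>2) *\<^sub>R carried G V j"
    by (simp add: settled_def algebra_simps power2_eq_square)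
  then show ?thesis using assms by simp
qed

lemma new_basis_split:
  assumes "(fst (G ! j))\<^sup>2 + (snd (G ! j))\<^sup>2 = 1"
  shows "V (Suc j) = snd (G ! j) *\<^sub>R settled G V j + fst (G ! j) *\<^sub>R carried G V (Suc j)"
proof -
  have "snd (G ! j) *\<^sub>R settled G V j + fst (G ! j) *\<^sub>R carried G V (Suc j)
      = ((fst (G ! j))\<^sup>2 + (snd (G ! j))\<^sup>2) *\<^sub>R V (Suc j)"
    by (simp add: settled_def algebra_simps power2_eq_square)
  then show ?thesis using assms by simp
qed

text \<open>
  Rotations preserve orthonormality. The basis may be zero beyond the index \<open>m\<close>, hence the
  different ranges of the assumptions.
\<close>
lemma carried_orthogonal:
  assumes orth: "\<And>i k. i < k \<Longrightarrow> V i \<bullet> V k = 0" and norm: "\<And>i. i \<le> m \<Longrightarrow> V i \<bullet> V i = 1"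
    and unit: "\<And>i. i < m \<Longrightarrow> (fst (G ! i))\<^sup>2 + (snd (G ! i))\<^sup>2 = 1" and "j \<le> m"
  shows "carried G V j \<bullet> carried G V j = 1 \<and> (\<forall>k>j. carried G V j \<bullet> V k = 0)
    \<and> (\<forall>i<j. settled G V i \<bullet> carried G V j = 0 \<and> (\<forall>k>j. settled G V i \<bullet> V k = 0))"
  using \<open>j \<le> m\<close>
proof (induction j)
  case 0
  then show ?case using orth norm by simp
next
  case (Suc j)
  let ?w = "carried G V j" and ?c = "fst (G ! j)" and ?s = "snd (G ! j)"
  have u: "?c\<^sup>2 + ?s\<^sup>2 = 1" using unit Suc.prems by simp
  have IH: "?w \<bullet> ?w = 1" "\<And>k. k > j \<Longrightarrow> ?w \<bullet> V k = 0" "\<And>i. i < j \<Longrightarrow> settled G V i \<bullet> ?w = 0"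
    "\<And>i k. i < j \<Longrightarrow> k > j \<Longrightarrow> settled G V i \<bullet> V k = 0"
    using Suc by auto
  have v: "V (Suc j) \<bullet> V (Suc j) = 1" using norm Suc.prems by simp
  have vw: "V (Suc j) \<bullet> ?w = 0" using IH(2)[of "Suc j"] by (simp add: inner_commute)
  have "carried G V (Suc j) \<bullet> carried G V (Suc j) = 1"
    using u by (simp add: inner_diff_left inner_diff_right IH v vw power2_eq_square)
  moreover have "carried G V (Suc j) \<bullet> V k = 0" if "k > Suc j" for k
    using that orth[of "Suc j" k] by (simp add: inner_diff_left IH)
  moreover have "settled G V i \<bullet> carried G V (Suc j) = 0" if "i < Suc j" for i
  proof (cases "i = j")
    case True
    then show ?thesis
      by (simp add: settled_def inner_diff_right inner_add_left IH v vw)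
  next
    case False
    then show ?thesis using that by (simp add: inner_diff_right IH)
  qed
  moreover have "settled G V i \<bullet> V k = 0" if "i < Suc j" "k > Suc j" for i k
  proof (cases "i = j")
    case True
    then show ?thesis using that orth[of "Suc j" k] by (simp add: settled_def inner_add_left IH)
  next
    case False
    then show ?thesis using that by (simp add: IH)
  qed
  ultimately show ?case by blast
qed

text \<open>
  Reducing a column only changes its coordinates: what was given in the old basis is now given by
  settled vectors. The statement starts at an intermediate position \<open>k\<close>, where the entries from
  \<open>k\<close> on refer to the carried vector and the basis vectors not yet used. The rotation \<open>j\<close> itself may be
  degenerate: if its pivot vanishes, both entries that it acts on are zero.
\<close>
lemma reduce_column_settled:
  fixes V :: "nat \<Rightarrow> 'a::real_vector"
  assumes "k \<le> j" "j < length G"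
    and "fst (reduce_column (drop k (take j G)) (a # h)) = (rs, G ! j)" "length h = Suc (j - k)"
    and unit: "\<And>i. i < j \<Longrightarrow> (fst (G ! i))\<^sup>2 + (snd (G ! i))\<^sup>2 = 1"
  shows "a *\<^sub>R carried G V k + lincomb h (\<lambda>i. V (Suc (k + i))) = lincomb rs (\<lambda>i. settled G V (k + i))"
  using assms(1,3,4)
proof (induction k arbitrary: a h rs rule: inc_induct)
  case base
  then obtain b where h: "h = [b]" by (auto simp: length_Suc_conv)
  define t where "t = sqrt (a * a + b * b)"
  have eqs: "rs = [t]" "G ! j = (a / t, b / t)"
    using base by (simp_all add: h counted_simps t_def)
  have "t * (a / t) = a" "t * (b / t) = b"
    by (auto simp: t_def sum_squares_eq_zero_iff)
  then show ?case
    by (simp add: h eqs lincomb_Cons settled_def scaleR_add_right)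
next
  case (step k)
  obtain b h' where h: "h = b # h'" and h': "length h' = Suc (j - Suc k)"
    using step.prems(2) step.hyps by (auto simp: length_Suc_conv Suc_diff_Suc)
  let ?c = "fst (G ! k)" and ?s = "snd (G ! k)"
  obtain c s where Gk: "G ! k = (c, s)" by fastforce
  have drop: "drop k (take j G) = (c, s) # drop (Suc k) (take j G)"
    using step.hyps assms(2) by (simp add: Cons_nth_drop_Suc[symmetric] Gk)
  obtain rs' where rec: "fst (reduce_column (drop (Suc k) (take j G)) ((?c * b - ?s * a) # h')) = (rs', G ! j)"
    and rs: "rs = (?c * a + ?s * b) # rs'"
    using step.prems(1) by (auto simp: h drop Gk counted_simps split_beta prod_eq_iff)
  have u: "?c\<^sup>2 + ?s\<^sup>2 = 1" using unit step.hyps by simp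
  have IH: "(?c * b - ?s * a) *\<^sub>R carried G V (Suc k) + lincomb h' (\<lambda>i. V (Suc (Suc k + i)))
      = lincomb rs' (\<lambda>i. settled G V (Suc k + i))"
    by (rule step.IH[OF rec h'])
  have "a *\<^sub>R carried G V k + b *\<^sub>R V (Suc k)
      = (?c * a + ?s * b) *\<^sub>R settled G V k + (?c * b - ?s * a) *\<^sub>R carried G V (Suc k)"
    by (subst carried_split[OF u], subst new_basis_split[OF u])
      (simp add: algebra_simps del: carried.simps)
  then have "a *\<^sub>R carried G V k + lincomb h (\<lambda>i. V (Suc (k + i)))
      = (?c * a + ?s * b) *\<^sub>R settled G V k
        + ((?c * b - ?s * a) *\<^sub>R carried G V (Suc k) + lincomb h' (\<lambda>i. V (Suc (Suc k + i))))"
    by (simp add: h lincomb_Cons add.assoc[symmetric] del: carried.simps)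
  then show ?case unfolding IH by (simp add: rs lincomb_Cons)
qed

text \<open>
  Back substitution cancels all settled components of \<open>\<beta> v\<close>. What is left is a multiple of the
  vector carried to the end, which is orthogonal to the settled vectors and hence to the columns
  of \<open>A V\<close>; after a breakdown that vector is zero. These are the normal equations.

  All pivots are nonzero: before a breakdown because of the subdiagonal entries, and at the
  breakdown because otherwise the last column of \<open>A V\<close> would be a combination of the others, which
  the injectivity of \<open>A\<close> and the orthonormality of \<open>V\<close> exclude.
\<close>
lemma hessenberg_ls_correct:
  fixes A :: "real^'n^'n"
  assumes inv: "arnoldi_inv A v V W H" and inj: "inj ((*v) A)"
    and run: "hessenberg_ls \<beta> H = (y, cost)"
  shows "length y = length H"
    and "i < length H \<Longrightarrow> (A *v (V ! i)) \<bullet> (\<beta> *\<^sub>R v - A *v lincomb y (\<lambda>j. V ! j)) = 0"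
    and "cost = 5 / 2 * (real (length H))\<^sup>2 + 11 / 2 * real (length H)"
proof -
  define m where "m = length H"
  define U where "U = nth_default 0 V"
  have V: "V \<noteq> []" "V ! 0 = v" "orthonormal V" "m \<le> length V" "length V \<le> Suc m"
    using inv by (auto simp: arnoldi_inv_def m_def)
  have H: "length (H ! j) = Suc (Suc j)" "A *v (V ! j) = lincomb (H ! j) U"
    "last (H ! j) \<noteq> 0 \<longleftrightarrow> Suc j < length V" if "j < m" for j
    using inv that unfolding arnoldi_inv_def m_def U_def by blast+
  obtain R g cost1 where qr: "givens_qr [] \<beta> H = ((R, g), cost1)" by (metis surj_pair)
  obtain cost2 where bs: "back_substitution (rev R) g [] = (y, cost2)" and cost: "cost = cost1 + cost2"
    using run by (auto simp: hessenberg_ls_def bind_counted_def qr prod_eq_iff)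
  obtain F t where F: "length F = m" "length R = m" "length g = m" "t 0 = \<beta>"
    "\<And>j. j < m \<Longrightarrow> fst (reduce_column (take j F) (H ! j)) = (R ! j, F ! j)"
    "\<And>j. j < m \<Longrightarrow> g ! j = fst (F ! j) * t j" "\<And>j. j < m \<Longrightarrow> t (Suc j) = - snd (F ! j) * t j"
    and cost1: "cost1 = 2 * (real m)\<^sup>2 + 5 * real m"
    using givens_qr_rotations[OF qr] H(1) by (auto simp: m_def)
  let ?Q = "settled F U"
  have red: "reduce_column (take j F) (H ! j)
      = ((R ! j, fst (F ! j), snd (F ! j)), snd (reduce_column (take j F) (H ! j)))" if "j < m" for j
    using F(5)[OF that] by (simp add: prod_eq_iff)
  have R: "length (R ! j) = Suc j" if "j < m" for j
    using reduce_column_length(1)[OF red[OF that]] H(1)[OF that] that F(1) by simp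
  have pivot: "last (H ! j) \<noteq> 0 \<longrightarrow> last (R ! j) \<noteq> 0" "last (H ! j) = 0 \<longrightarrow> snd (F ! j) = 0"
    "last (R ! j) \<noteq> 0 \<longrightarrow> (fst (F ! j))\<^sup>2 + (snd (F ! j))\<^sup>2 = 1" if "j < m" for j
    using reduce_column_pivot[OF red[OF that]] H(1)[OF that] that F(1) by simp_all
  have col: "A *v (V ! j) = lincomb (R ! j) ?Q"
    if j: "j < m" and unit: "\<And>i. i < j \<Longrightarrow> (fst (F ! i))\<^sup>2 + (snd (F ! i))\<^sup>2 = 1" for j
  proof -
    obtain a h where ah: "H ! j = a # h" "length h = Suc j"
      using H(1)[OF j] by (auto simp: length_Suc_conv)
    have "fst (reduce_column (drop 0 (take j F)) (a # h)) = (R ! j, F ! j)"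
      using F(5)[OF j] by (simp add: ah)
    from reduce_column_settled[OF _ _ this _ unit, of U] j F(1) ah
    show ?thesis by (simp add: H(2)[OF j] lincomb_Cons)
  qed
  have early: "last (R ! i) \<noteq> 0" if "Suc i < length V" "i < m" for i
    using pivot(1)[of i] H(3)[of i] that by simp
  have nonzero: "last (R ! j) \<noteq> 0" if j: "j < m" for j
  proof (cases "Suc j < length V")
    case True
    then show ?thesis using early j by blast
  next
    case False
    then have len: "length V = Suc j" using j V(4) by simp
    have col': "A *v (V ! i) = lincomb (R ! i) ?Q" if "i \<le> j" for i
      using that j len early pivot(3) by (intro col) auto
    show ?thesis
    proof
      assume "last (R ! j) = 0"
      then have drop: "A *v (V ! j) = lincomb (butlast (R ! j)) ?Q"
        using col'[of j] lincomb_butlast_last[OF R[OF j], of ?Q] by simp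
      obtain zs cost' where "back_substitution (rev (take j R)) (butlast (R ! j)) [] = (zs, cost')"
        by (metis surj_pair)
      \<comment> \<open>The columns before \<open>j\<close> have nonzero pivots, so back substitution writes column \<open>j\<close> as a
         combination of them.\<close>
      from back_substitution_correct[OF this, where 'a = "real^'n"]
      obtain z where z: "length z = j"
        "lincomb z (\<lambda>i. lincomb (take j R ! i) ?Q) = lincomb (butlast (R ! j)) ?Q"
        using R early j len F(2) by auto
      have "A *v lincomb z (\<lambda>i. V ! i) = lincomb z (\<lambda>i. lincomb (take j R ! i) ?Q)"
        unfolding matrix_mult_lincomb by (rule lincomb_cong) (simp_all add: z(1) col')
      then have "A *v (V ! j) = A *v lincomb z (\<lambda>i. V ! i)" using drop z(2) by simp
      then have "V ! j = lincomb z (\<lambda>i. V ! i)" by (rule injD[OF inj])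
      moreover have "V ! j \<bullet> lincomb z (\<lambda>i. V ! i) = 0"
        using len z(1) by (intro inner_lincomb_eq_0) (simp add: orthonormal_nth[OF V(3)])
      ultimately show False using orthonormal_nth[OF V(3), of j j] len by simp
    qed
  qed
  have unit: "(fst (F ! j))\<^sup>2 + (snd (F ! j))\<^sup>2 = 1" if "j < m" for j
    using pivot(3) nonzero that by blast
  have colm: "A *v (V ! j) = lincomb (R ! j) ?Q" if "j < m" for j
    using that unit by (intro col) auto
  from back_substitution_correct[OF bs, where 'a = "real^'n"] R nonzero F(2,3)
  have y: "length y = m" "lincomb y (\<lambda>j. lincomb (R ! j) ?Q) = lincomb g ?Q"
    and cost2: "cost2 = real m * (real m + 1) / 2"
    by auto
  show "length y = length H" using y(1) by (simp add: m_def)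
  show "cost = 5 / 2 * (real (length H))\<^sup>2 + 11 / 2 * real (length H)"
    unfolding m_def[symmetric] cost cost1 cost2 by (simp add: field_simps power2_eq_square)
  \<comment> \<open>The right-hand side after \<open>k\<close> rotations, in the basis of settled vectors and one carried
     vector.\<close>
  have rhs: "\<beta> *\<^sub>R v = lincomb (take k g) ?Q + t k *\<^sub>R carried F U k" if "k \<le> m" for k
    using that
  proof (induction k)
    case 0
    then show ?case using V(1,2) by (simp add: F(4) U_def nth_default_nth)
  next
    case (Suc k)
    then have "lincomb (take (Suc k) g) ?Q = lincomb (take k g) ?Q + (fst (F ! k) * t k) *\<^sub>R ?Q k"
      by (simp add: take_Suc_conv_app_nth F(3,6) lincomb_snoc)
    moreover have "t k *\<^sub>R carried F U k
        = (fst (F ! k) * t k) *\<^sub>R ?Q k + t (Suc k) *\<^sub>R carried F U (Suc k)"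
      using Suc.prems by (subst carried_split[OF unit])
        (simp_all add: F(7) scaleR_diff_right mult.commute del: carried.simps)
    ultimately show ?case using Suc by (simp del: carried.simps)
  qed
  have "A *v lincomb y (\<lambda>j. V ! j) = lincomb y (\<lambda>j. lincomb (R ! j) ?Q)"
    unfolding matrix_mult_lincomb by (rule lincomb_cong) (simp_all add: y(1) colm)
  then have res: "\<beta> *\<^sub>R v - A *v lincomb y (\<lambda>j. V ! j) = t m *\<^sub>R carried F U m"
    using rhs[of m] by (simp add: y(2) F(3))
  have "?Q k \<bullet> carried F U m = 0" if "k < m" for k
  proof (cases "length V = Suc m")
    case True
    have "U i \<bullet> U k = 0" if "i < k" for i k
      using that orthonormal_nth[OF V(3), of i k] by (cases "k < length V") (simp_all add: U_def nth_default_def)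
    moreover have "U i \<bullet> U i = 1" if "i \<le> m" for i
      using that True orthonormal_nth[OF V(3), of i i] by (simp add: U_def nth_default_def)
    ultimately show ?thesis using carried_orthogonal[of U m F m] unit that by blast
  next
    case False
    then have len: "length V = m" using V(4,5) by simp
    then obtain n where n: "m = Suc n" using V(1) by (cases m) auto
    have "snd (F ! n) = 0" using pivot(2)[of n] H(3)[of n] len n by simp
    moreover have "U m = 0" using len by (simp add: U_def nth_default_def)
    ultimately show ?thesis by (simp add: n)
  qed
  then have "carried F U m \<bullet> lincomb (R ! i) ?Q = 0" if "i < m" for i
    using that R[OF that] by (intro inner_lincomb_eq_0) (simp add: inner_commute)
  then show "(A *v (V ! i)) \<bullet> (\<beta> *\<^sub>R v - A *v lincomb y (\<lambda>j. V ! j)) = 0" if "i < length H"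
    using that colm[of i] by (simp add: res inner_commute m_def)
qed

section \<open>The outer step\<close>

lemma lincomb_padded:
  assumes "\<And>i. N \<le> i \<Longrightarrow> Q i = 0"
  shows "lincomb xs Q = (\<Sum>i<N. nth_default 0 xs i *\<^sub>R Q i)"
proof -
  have "lincomb xs Q = (\<Sum>i<max N (length xs). nth_default 0 xs i *\<^sub>R Q i)"
    unfolding lincomb_def by (rule sum.mono_neutral_cong_left) (auto simp: nth_default_def)
  also have "\<dots> = (\<Sum>i<N. nth_default 0 xs i *\<^sub>R Q i)"
    using assms by (intro sum.mono_neutral_right) auto
  finally show ?thesis .
qed

lemma lincomb_in_span: "\<lbrakk>subspace S; \<And>i. i < length xs \<Longrightarrow> Q i \<in> S\<rbrakk> \<Longrightarrow> lincomb xs Q \<in> S"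
  unfolding lincomb_def by (intro subspace_sum subspace_scale) auto

text \<open>
  The Krylov space lies in the span by the Hessenberg relation; at a breakdown the span is
  invariant under \<open>A\<close>, so this covers all powers. Conversely each new basis vector is obtained from
  the preceding relation by dividing by a subdiagonal entry, which is nonzero. As the basis
  is orthonormal, its length is the dimension.
\<close>
lemma arnoldi_inv_decomposition:
  fixes A :: "real^'n^'n"
  assumes inv: "arnoldi_inv A ((1 / norm r) *\<^sub>R r) V W H" and r: "r \<noteq> 0"
    and lens: "length V = Suc (length H) \<and> length H = l \<or> length V = length H \<and> length H \<le> l"
  shows "arnoldi_decomposition A r l (length V) (length H) (nth_default 0 V) (\<lambda>i j. nth_default 0 (H ! j) i)"
proof -
  define U where "U = nth_default 0 V"
  have V: "V \<noteq> []" "V ! 0 = (1 / norm r) *\<^sub>R r" "orthonormal V"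
    using inv by (auto simp: arnoldi_inv_def)
  have H: "length (H ! j) = Suc (Suc j)" "A *v (V ! j) = lincomb (H ! j) U"
    "last (H ! j) \<noteq> 0 \<longleftrightarrow> Suc j < length V" if "j < length H" for j
    using inv that unfolding arnoldi_inv_def U_def by blast+
  have U: "U i = V ! i" if "i < length V" for i using that by (simp add: U_def nth_default_def)
  have U0: "U i = 0" if "length V \<le> i" for i using that by (simp add: U_def nth_default_def)
  have set: "U ` {..<length V} = set V"
    using U by (auto simp: set_conv_nth image_iff)
  have step: "A *v U j \<in> span (U ` {..Suc j})" if "j < l" for j
  proof (cases "j < length H")
    case True
    have "lincomb (H ! j) U \<in> span (U ` {..Suc j})"
      using H(1)[OF True] by (intro lincomb_in_span subspace_span span_base) auto
    then show ?thesis using H(2)[OF True] True lens by (auto simp: U)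
  next
    case False
    then show ?thesis using lens that U0[of j] by (auto simp: span_zero)
  qed
  have "r = norm r *\<^sub>R U 0" using r V by (simp add: U)
  then have r0: "r \<in> span {U 0}" by (metis insertI1 span_base span_scale)
  have "krylov A r (l + 1) \<subseteq> span (set V)"
  proof -
    have "(((*v) A) ^^ i) r \<in> span (set V)" if "i < l + 1" for i
    proof -
      have "(((*v) A) ^^ i) r \<in> span (U ` {..i})"
        using power_in_span_basis[OF r0 step] that by simp
      also have "\<dots> \<subseteq> span (set V)"
      proof (rule span_minimal[OF _ subspace_span], clarify)
        fix k
        show "U k \<in> span (set V)"
          by (cases "k < length V") (simp_all add: U U0 span_base span_zero)
      qed
      finally show ?thesis .
    qed
    then show ?thesis unfolding krylov_def by (intro span_minimal subspace_span) auto
  qed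
  moreover have basis: "V ! i \<in> krylov A r (Suc i)" if "i < length V" for i
    using that
  proof (induction i rule: less_induct)
    case (less i)
    show ?case
    proof (cases i)
      case 0
      then show ?thesis using V(2) power_in_krylov[of 0 "Suc 0" A r]
        by (simp add: subspace_scale subspace_krylov)
    next
      case (Suc j)
      have j: "j < length H" "Suc j < length V" using Suc less.prems lens by auto
      have \<eta>: "last (H ! j) \<noteq> 0" using H(3) j by blast
      have "A *v (V ! j) = lincomb (butlast (H ! j)) U + last (H ! j) *\<^sub>R V ! i"
        using H(2)[OF j(1)] lincomb_butlast_last[OF H(1)[OF j(1)], of U] j(2) Suc by (simp add: U)
      then have "V ! i = (1 / last (H ! j)) *\<^sub>R (A *v (V ! j) - lincomb (butlast (H ! j)) U)"
        using \<eta> by simp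
      moreover have "A *v (V ! j) \<in> krylov A r (Suc i)"
        using krylov_mult[OF less.IH[of j]] Suc less.prems by simp
      moreover have "lincomb (butlast (H ! j)) U \<in> krylov A r (Suc i)"
      proof (rule lincomb_in_span[OF subspace_krylov])
        fix k assume "k < length (butlast (H ! j))"
        then have "k < i" "k < length V" using H(1)[OF j(1)] Suc j(2) by auto
        then show "U k \<in> krylov A r (Suc i)"
          using less.IH[of k] krylov_mono[of "Suc k" "Suc i" A r] by (auto simp: U)
      qed
      ultimately show ?thesis
        by (metis subspace_diff subspace_krylov subspace_scale)
    qed
  qed
  have "set V \<subseteq> krylov A r (l + 1)"
  proof
    fix u assume "u \<in> set V"
    then obtain i where i: "i < length V" "u = V ! i" by (metis in_set_conv_nth)
    then have "Suc i \<le> l + 1" using lens by auto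
    then show "u \<in> krylov A r (l + 1)"
      using basis[OF i(1)] krylov_mono[of "Suc i" "l + 1" A r] by (auto simp: i(2))
  qed
  then have "span (set V) \<subseteq> krylov A r (l + 1)" by (rule span_minimal[OF _ subspace_krylov])
  ultimately have span: "span (set V) = krylov A r (l + 1)" by blast
  then have dim: "dim (krylov A r (l + 1)) = length V"
    using dim_span_orthonormal[OF V(3)] by simp
  have "A *v U j = (\<Sum>i<length V. nth_default 0 (H ! j) i *\<^sub>R U i)" if "j < length H" for j
  proof -
    have "j < length V" using that lens by auto
    then show ?thesis using H(2)[OF that] lincomb_padded[of "length V" U "H ! j"] U0 by (simp add: U)
  qed
  moreover have "U i \<bullet> U j = (if i = j then 1 else 0)" if "i < length V" "j < length V" for i j
    using orthonormal_nth[OF V(3)] that by (simp add: U)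
  ultimately show ?thesis
    unfolding arnoldi_decomposition_def U_def[symmetric]
    using dim lens V(1,2) span set H(1) by (auto simp: U nth_default_def)
qed

text \<open>
  Any other residual differs by an element of the range of \<open>A V\<close>, to which the given residual is
  orthogonal; the theorem of Pythagoras then compares the norms.
\<close>
lemma normal_equations_arg_min:
  fixes A :: "real^'n^'n"
  assumes dec: "arnoldi_decomposition A r l d m V H" and r: "r \<noteq> 0"
    and normal: "\<And>i. i < m \<Longrightarrow> (A *v V i) \<bullet> (r - A *v (\<Sum>j<m. y j *\<^sub>R V j)) = 0"
  shows "is_arg_min (ls_objective d m (norm r) H) (\<lambda>_. True) y"
proof -
  let ?s = "\<lambda>z. r - A *v (\<Sum>j<m. z j *\<^sub>R V j)"
  have "(norm (?s y))\<^sup>2 \<le> (norm (?s z))\<^sup>2" for z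
  proof -
    define w where "w = (\<Sum>j<m. (y j - z j) *\<^sub>R (A *v V j))"
    have "?s z = ?s y + w"
      by (simp add: w_def linear_sum[OF matrix_vector_mul_linear] matrix_vector_mult_scaleR
          scaleR_left_diff_distrib sum_subtractf)
    moreover have "?s y \<bullet> w = 0"
      using normal by (simp add: w_def inner_sum_right inner_commute)
    ultimately have "(norm (?s z))\<^sup>2 = (norm (?s y))\<^sup>2 + (norm w)\<^sup>2"
      by (metis norm_add_Pythagorean orthogonal_def)
    then show ?thesis by simp
  qed
  then show ?thesis
    by (simp add: is_arg_min_def not_less ls_objective_eq_residual[OF dec r])
qed

lemma add_combination_correct:
  fixes vs :: "(real^'n) list"
  assumes "length ys \<le> length vs"
  shows "add_combination ys vs x = (x + lincomb ys (\<lambda>i. vs ! i), real CARD('n) * real (length ys))"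
  using assms
proof (induction ys vs x rule: add_combination.induct)
  case (1 y ys v vs x)
  then show ?case by (simp add: counted_simps lincomb_Cons algebra_simps)
qed (auto simp: ret_def)

lemma lincomb_uminus: "lincomb (map uminus ys) Q = - lincomb ys Q"
  by (simp add: lincomb_def sum_negf)

text \<open>
  The exact count in terms of the number \<open>m\<close> of Arnoldi steps and the number \<open>d\<close> of basis vectors:
  the Arnoldi process and the least-squares problem as above, \<open>2 n + 1\<close> for the normalization of
  the residual, and \<open>2 n m\<close> for the two updates.
\<close>
lemma gmres_outer_correct:
  fixes A :: "real^'n^'n" and \<gamma> :: real
  assumes pd: "sym_pos_def (sym_part A)" and r: "residual A b x \<noteq> 0"
    and run: "gmres_outer \<gamma> A l (x, residual A b x) = ((x', r'), cost)"
  shows "gmres_step A b l x x'" and "r' = residual A b x'"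
    and "\<exists>d m. d = dim (krylov A (residual A b x) (l + 1)) \<and> (d = Suc m \<and> m = l \<or> d = m \<and> m \<le> l)
      \<and> cost = real m * cost_Mv \<gamma> A + real CARD('n) * ((real m)\<^sup>2 + 4 * real m + real d + 1)
          + 5 / 2 * (real m)\<^sup>2 + 13 / 2 * real m + 1"
proof -
  define r where "r = residual A b x"
  define v where "v = (1 / norm r) *\<^sub>R r"
  have r0: "r \<noteq> 0" using r by (simp add: r_def)
  obtain V W H acost where arn: "arnoldi \<gamma> A l [v] [] [] = ((V, W, H), acost)" by (metis surj_pair)
  obtain y lcost where ls: "hessenberg_ls (norm r) H = (y, lcost)" by (metis surj_pair)
  have "v \<bullet> v = 1" using r0 by (simp add: v_def dot_square_norm power2_eq_square)
  from arnoldi_correct[OF arn arnoldi_inv_init[OF this]]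
  have inv: "arnoldi_inv A v V W H"
    and lens: "length V = Suc (length H) \<and> length H = l \<or> length V = length H \<and> length H \<le> l"
    and acost: "acost = real (length H) * cost_Mv \<gamma> A
      + real CARD('n) * (real (length H) * (real (length H) + 2)) + real (length H)
      + real CARD('n) * (real (length V) - 1)"
    by auto
  have lenV: "length H \<le> length V" using lens by auto
  have W: "W = map ((*v) A) (take (length H) V)" using inv by (simp add: arnoldi_inv_def)
  note hls = hessenberg_ls_correct[OF inv pos_def_inj[OF pd] ls]
  have norm: "sqrt (r \<bullet> r) = norm r" by (simp add: norm_eq_sqrt_inner)
  have "x' = fst (add_combination y V x)" "r' = fst (add_combination (map uminus y) W r)"
    and cost: "cost = 2 * real CARD('n) + 1 + acost + lcost + snd (add_combination y V x)
      + snd (add_combination (map uminus y) W r)"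
    using run r0 unfolding r_def[symmetric] gmres_outer_def
    by (auto simp: counted_simps norm v_def[symmetric] arn ls)
  then have x': "x' = x + lincomb y (\<lambda>j. V ! j)" and r': "r' = r - lincomb y (\<lambda>j. W ! j)"
    and cost': "cost = 2 * real CARD('n) + 1 + acost + lcost + 2 * real CARD('n) * real (length H)"
    using hls(1) lenV by (simp_all add: add_combination_correct lincomb_uminus W)
  have "lincomb y (\<lambda>j. W ! j) = A *v lincomb y (\<lambda>j. V ! j)"
    unfolding matrix_mult_lincomb using hls(1) lenV by (intro lincomb_cong) (simp_all add: W)
  then show "r' = residual A b x'"
    by (simp add: r' x' residual_add r_def)
  note dec = arnoldi_inv_decomposition[OF inv[unfolded v_def] r0 lens]
  have comb: "lincomb y (\<lambda>j. V ! j) = (\<Sum>j<length H. y ! j *\<^sub>R nth_default 0 V j)"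
    unfolding lincomb_def using hls(1) lenV by (intro sum.cong) (auto simp: nth_default_def)
  have arg_min: "is_arg_min (ls_objective (length V) (length H) (norm r) (\<lambda>i j. nth_default 0 (H ! j) i))
      (\<lambda>_. True) (\<lambda>j. y ! j)"
  proof (rule normal_equations_arg_min[OF dec r0])
    fix i assume i: "i < length H"
    have "norm r *\<^sub>R v = r" using r0 by (simp add: v_def)
    then show "(A *v nth_default 0 V i) \<bullet> (r - A *v (\<Sum>j<length H. y ! j *\<^sub>R nth_default 0 V j)) = 0"
      unfolding comb[symmetric] using hls(2)[OF i] i lenV by (simp add: nth_default_def)
  qed
  show "gmres_step A b l x x'"
    unfolding gmres_step_def r_def[symmetric] if_not_P[OF r0]
    by (intro exI conjI, rule dec, rule arg_min) (rule x'[unfolded comb])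
  have "length V = dim (krylov A r (l + 1))" using dec by (simp add: arnoldi_decomposition_def)
  moreover have "cost = real (length H) * cost_Mv \<gamma> A
      + real CARD('n) * ((real (length H))\<^sup>2 + 4 * real (length H) + real (length V) + 1)
      + 5 / 2 * (real (length H))\<^sup>2 + 13 / 2 * real (length H) + 1"
    unfolding cost' acost hls(3) by (simp add: algebra_simps power2_eq_square)
  ultimately show "\<exists>d m. d = dim (krylov A (residual A b x) (l + 1)) \<and> (d = Suc m \<and> m = l \<or> d = m \<and> m \<le> l)
      \<and> cost = real m * cost_Mv \<gamma> A + real CARD('n) * ((real m)\<^sup>2 + 4 * real m + real d + 1)
          + 5 / 2 * (real m)\<^sup>2 + 13 / 2 * real m + 1"
    using lens unfolding r_def[symmetric] by blast
qed

text \<open>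
  \<open>C\<close> is the count for \<open>L\<close> steps without breakdown, apart from the matrix-vector products. It
  is at most \<open>8 N L\<^sup>2 + 10 L\<^sup>2\<close> as \<open>L \<ge> 1\<close>, and \<open>N \<ge> 1\<close> turns one of the ten terms \<open>L\<^sup>2\<close> into \<open>N L\<^sup>2\<close>.
  Equality holds at \<open>N = L = 1\<close>, so the factor \<open>9\<close> is sharp.
\<close>
lemma outer_step_cost_bounds:
  fixes N L :: real
  assumes N: "1 \<le> N" and L: "1 \<le> L"
  defines "C \<equiv> N * (L\<^sup>2 + 5 * L + 2) + 5 / 2 * L\<^sup>2 + 13 / 2 * L + 1"
  shows "C \<le> 9 * (N * L\<^sup>2 + L\<^sup>2)" "N * L\<^sup>2 + L\<^sup>2 \<le> C"
proof -
  have L2: "L \<le> L\<^sup>2" "1 \<le> L\<^sup>2" using L by (simp_all add: self_le_power)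
  then have "N * L \<le> N * L\<^sup>2" "N * 1 \<le> N * L\<^sup>2" "1 * L\<^sup>2 \<le> N * L\<^sup>2" "0 \<le> N * L"
    using N L by (auto intro!: mult_left_mono mult_right_mono)
  with L2 N L show "C \<le> 9 * (N * L\<^sup>2 + L\<^sup>2)" "N * L\<^sup>2 + L\<^sup>2 \<le> C"
    unfolding C_def distrib_left by linarith+
qed

theorem corollary3:
  fixes A :: "real^'n^'n" and b :: "real^'n" and l :: nat
  assumes "sym_pos_def (sym_part A)" and "l \<ge> 1"
  shows
    "(\<forall>(x :: nat \<Rightarrow> real^'n) k.
        residual A b (x 0) \<noteq> 0 \<and> (\<forall>i<k. gmres_step A b l (x i) (x (Suc i))) \<longrightarrow>
        norm (residual A b (x k)) / norm (residual A b (x 0))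
          \<le> sqrt (1 - (lambda_min (sym_part A))\<^sup>2 / (onorm ((*v) A))\<^sup>2) ^ (k * l))
     \<and>
     (\<forall>(\<gamma> :: real) x x' r' cost.
        \<gamma> > 0 \<and> residual A b x \<noteq> 0 \<and>
        gmres_outer \<gamma> A l (x, residual A b x) = ((x', r'), cost) \<longrightarrow>
        gmres_step A b l x x' \<and> r' = residual A b x' \<and>
        cost \<le> real l * cost_Mv \<gamma> A + 9 * (real CARD('n) * (real l)\<^sup>2 + (real l)\<^sup>2) \<and>
        (dim (krylov A (residual A b x) (l + 1)) = l + 1 \<longrightarrow>
          (\<exists>c\<^sub>7. 1 \<le> c\<^sub>7 \<and> c\<^sub>7 \<le> 9 \<and>
            cost = real l * cost_Mv \<gamma> A + c\<^sub>7 * (real CARD('n) * (real l)\<^sup>2 + (real l)\<^sup>2))))"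
proof (intro conjI allI impI; elim conjE)
  fix x :: "nat \<Rightarrow> real^'n" and k
  assume "residual A b (x 0) \<noteq> 0" "\<forall>i<k. gmres_step A b l (x i) (x (Suc i))"
  then show "norm (residual A b (x k)) / norm (residual A b (x 0))
      \<le> sqrt (1 - (lambda_min (sym_part A))\<^sup>2 / (onorm ((*v) A))\<^sup>2) ^ (k * l)"
    using gmres_convergence[OF assms(1), of k b l x] by (simp add: divide_le_eq)
next
  fix \<gamma> :: real and x x' r' :: "real^'n" and cost
  assume \<gamma>: "\<gamma> > 0" and r: "residual A b x \<noteq> 0"
    and run: "gmres_outer \<gamma> A l (x, residual A b x) = ((x', r'), cost)"
  note outer = gmres_outer_correct[OF assms(1) r run]
  show "gmres_step A b l x x'" "r' = residual A b x'" by (rule outer(1,2))+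
  let ?N = "real CARD('n)" and ?L = "real l"
  let ?C = "?N * (?L\<^sup>2 + 5 * ?L + 2) + 5 / 2 * ?L\<^sup>2 + 13 / 2 * ?L + 1"
  obtain d m where d: "d = dim (krylov A (residual A b x) (l + 1))"
    and dm: "d = Suc m \<and> m = l \<or> d = m \<and> m \<le> l"
    and cost: "cost = real m * cost_Mv \<gamma> A + ?N * ((real m)\<^sup>2 + 4 * real m + real d + 1)
          + 5 / 2 * (real m)\<^sup>2 + 13 / 2 * real m + 1"
    using outer(3) by blast
  have N: "1 \<le> ?N" by (simp add: Suc_leI)
  note bounds = outer_step_cost_bounds[OF N, of ?L]
  have m: "real m \<le> ?L" "real d \<le> ?L + 1" using dm by auto
  \<comment> \<open>The count grows with \<open>m\<close> and \<open>d\<close>, so a breakdown cannot raise it above the regular one.\<close>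
  have "real m * cost_Mv \<gamma> A \<le> ?L * cost_Mv \<gamma> A"
    using m(1) \<gamma> by (intro mult_right_mono) (simp_all add: cost_Mv_def)
  moreover have m2: "(real m)\<^sup>2 \<le> ?L\<^sup>2" using m(1) by (intro power_mono) auto
  moreover have "?N * ((real m)\<^sup>2 + 4 * real m + real d + 1) \<le> ?N * (?L\<^sup>2 + 5 * ?L + 2)"
    by (rule mult_left_mono) (use m m2 in linarith)+
  ultimately have "cost \<le> ?L * cost_Mv \<gamma> A + ?C"
    using m(1) unfolding cost by linarith
  then show "cost \<le> ?L * cost_Mv \<gamma> A + 9 * (?N * ?L\<^sup>2 + ?L\<^sup>2)"
    using bounds assms(2) by simp
  assume "dim (krylov A (residual A b x) (l + 1)) = l + 1"
  then have "cost = ?L * cost_Mv \<gamma> A + ?C"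
    using d dm by (auto simp: cost)
  moreover have pos: "0 < ?N * ?L\<^sup>2 + ?L\<^sup>2" using N assms(2) by (intro add_pos_pos) auto
  ultimately show "\<exists>c\<^sub>7. 1 \<le> c\<^sub>7 \<and> c\<^sub>7 \<le> 9 \<and> cost = ?L * cost_Mv \<gamma> A + c\<^sub>7 * (?N * ?L\<^sup>2 + ?L\<^sup>2)"
    using bounds assms(2)
    by (intro exI[of _ "?C / (?N * ?L\<^sup>2 + ?L\<^sup>2)"]) (simp add: divide_le_eq le_divide_eq)
qed

end
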